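(* Let $n\ge 0$ and suppose $(\phi_h^{n},\mu_h^{n},\mathbf u_h^{n},r_h^{n})$ and $(\phi_h^{n+1},\mu_h^{n+1},\mathbf u_h^{n+1},p_h^{n+1},r_h^{n+1})$ are consecutive iterates of the fully discrete SAV finite element scheme described in the context. Then, for every time step size $\Delta t>0$ and every mesh (i.e. unconditionally), $$\tilde E_h^{n+1}-\tilde E_h^{n}\le -\Delta t\left(\|\nabla\mu_h^{n+1}\|_0^2+\|\nabla\mathbf u_h^{n+1}\|_0^2\right),$$ where $$\tilde E_h^{n}=\int_\Omega\tfrac12\left(|\mathbf u_h^n|^2+|\nabla\phi_h^n|^2\right)dx+|r_h^n|^2 .$$
   Context: **Setting.** $\Omega\subset\mathbb R^d$ ($d=2,3$) is a polygonal domain; $(\cdot,\cdot)$ and $\|\cdot\|_0$ are the $L^2(\Omega)$ inner product and norm (scalar or vector fields). Fix $\varepsilon>0$, $F(\phi)=\frac1{4\varepsilon^2}(1-\phi^2)^2$, $g=F'$. Fix $C_0>0$ and set $E_1[\phi]=\int_\Omega F(\phi)\,dx+C_0$, so $E_1\ge C_0>0$. $\mathcal T_h$ is a shape-regular simplicial triangulation of $\Omega$ with mesh size $h$; $T>0$, $\Delta t=T/N$, $t^n=n\Delta t$, $d_tf^{n+1}=(f^{n+1}-f^n)/\Delta t$. **Finite element spaces.** $W_h$: continuous functions on $\Omega$ that are $P_1$ on each $K\in\mathcal T_h$. $\mathbf X_h$: continuous vector fields in $\mathbf H_0^1(\Omega)$ whose restriction to each $K$ lies in $(P_1(K)\oplus\mathrm{span}\{\hat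 b\})^d$, where $\hat b\in H^1_0(K)$ is the bubble function on $K$ ($0\le\hat b\le1$, equal to $1$ at the barycenter). $M_h$: continuous piecewise $P_1$ functions with zero mean on $\Omega$. **Scheme.** Given $(\phi_h^n,\mu_h^n,\mathbf u_h^n,r_h^n)$, with $E_{1,h}^n=E_1[\phi_h^n]$, find $(\phi_h^{n+1},\mu_h^{n+1},\mathbf u_h^{n+1},p_h^{n+1},r_h^{n+1})\in W_h\times W_h\times\mathbf X_h\times M_h\times\mathbb R$ such that for all $(\psi_h,\tau_h,\mathbf v_h,q_h)\in W_h\times W_h\times\mathbf X_h\times M_h$: $$(d_t\phi_h^{n+1},\psi_h)+(\nabla\mu_h^{n+1},\nabla\psi_h)+\tfrac{r_h^n}{\sqrt{E_{1,h}^n}}(\mathbf u_h^n\cdot\nabla\phi_h^n,\psi_h)=0,$$ $$(\mu_h^{n+1},\tau_h)-(\nabla\phi_h^{n+1},\nabla\tau_h)-(g(\phi_h^n),\tau_h)=0,$$ $$(d_t\mathbf u_h^{n+1},\mathbf v_h)+\tfrac{r_h^n}{\sqrt{E_{1,h}^n}}(\mathbf u_h^n\cdot\nabla\mathbf u_h^n,\mathbf v_h)-(p_h^{n+1},\nabla\cdot\mathbf v_h)+(\nabla\mathbf u_h^{n+1},\nabla\mathbf v_h)-\tfrac{r_h^n}{\sqrt{E_{1,h}^n}}(\mu_h^n\nabla\phi_h^n,\mathbf v_h)=0,$$ $$(\nabla\cdot\mathbf u_h^{n+1},q_h)=0,$$ $$d_tr_h^{n+1}=\tfrac1{2r_h^{n+1}}\Big((g(\phi_h^n),d_t\phi_h^{n+1})+\tfrac{r_h^n}{\sqrt{E_{1,h}^n}}\big((\mathbf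 u_h^n\cdot\nabla\mathbf u_h^n,\mathbf u_h^{n+1})+(\mathbf u_h^n\cdot\nabla\phi_h^n,\mu_h^{n+1})-(\mu_h^n\nabla\phi_h^n,\mathbf u_h^{n+1})\big)\Big)$$ (in particular $r_h^{n+1}\neq0$ is part of being a solution). **Initialization.** $\phi_h^0=R_h\phi^0$, $\mu_h^0=R_h\mu^0$, $\mathbf u_h^0=P_h\mathbf u^0$, $r_h^0=\sqrt{E_1[\phi_h^0]}$, where $R_h:H^1(\Omega)\to W_h$ is the Ritz projection, $(\nabla R_h\phi,\nabla\psi_h)=(\nabla\phi,\nabla\psi_h)$ for all $\psi_h\in W_h$, and $P_h:\mathbf L^2(\Omega)\to\mathbf X_h$ is the $L^2$-orthogonal projection. *)

theory Defs
  imports "HOL-Analysis.Analysis"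
begin

text \<open>Elements of function spaces are honest functions on the whole type; only their values on
  \<open>\<Omega>\<close> (for finite element functions: on the closure of \<open>\<Omega>\<close>) matter.\<close>

definition L2_space :: "'a::euclidean_space set \<Rightarrow> ('a \<Rightarrow> 'b::euclidean_space) set" where
  "L2_space \<Omega> = {f. f \<in> borel_measurable (lebesgue_on \<Omega>) \<and>
                    integrable (lebesgue_on \<Omega>) (\<lambda>x. (norm (f x))\<^sup>2)}"

text \<open>On \<open>real^'n^'n\<close> the inner product \<open>\<bullet>\<close> is the Frobenius product, so the following also covers
  \<open>(\<nabla>u, \<nabla>v)\<close> for vector fields.\<close>

definition l2_inner :: "'a::euclidean_space set \<Rightarrow> ('a \<Rightarrow> 'b::euclidean_space) \<Rightarrow> ('a \<Rightarrow> 'b) \<Rightarrow> real" where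
  "l2_inner \<Omega> f g = (LINT x|lebesgue_on \<Omega>. f x \<bullet> g x)"

definition l2_norm :: "'a::euclidean_space set \<Rightarrow> ('a \<Rightarrow> 'b::euclidean_space) \<Rightarrow> real" where
  "l2_norm \<Omega> f = sqrt (l2_inner \<Omega> f f)"

primrec Ck :: "nat \<Rightarrow> ('a::real_normed_vector \<Rightarrow> real) \<Rightarrow> bool" where
  "Ck 0 f \<longleftrightarrow> continuous_on UNIV f"
| "Ck (Suc k) f \<longleftrightarrow> (\<forall>x. f differentiable (at x)) \<and>
                    (\<forall>v. Ck k (\<lambda>x. frechet_derivative f (at x) v))"

definition test_functions :: "'a::euclidean_space set \<Rightarrow> ('a \<Rightarrow> real) set" where
  "test_functions \<Omega> = {\<eta>. (\<forall>k. Ck k \<eta>) \<and> compact (closure {x. \<eta> x \<noteq> 0}) \<and>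
                           closure {x. \<eta> x \<noteq> 0} \<subseteq> \<Omega>}"

definition has_weak_gradient ::
  "(real^'n) set \<Rightarrow> (real^'n \<Rightarrow> real) \<Rightarrow> (real^'n \<Rightarrow> real^'n) \<Rightarrow> bool" where
  "has_weak_gradient \<Omega> f G \<longleftrightarrow> f \<in> L2_space \<Omega> \<and> G \<in> L2_space \<Omega> \<and>
     (\<forall>\<eta>\<in>test_functions \<Omega>. \<forall>i.
        (LINT x|lebesgue_on \<Omega>. f x * frechet_derivative \<eta> (at x) (axis i 1)) =
        - (LINT x|lebesgue_on \<Omega>. G x $ i * \<eta> x))"

definition H1_space :: "(real^'n) set \<Rightarrow> (real^'n \<Rightarrow> real) set" where
  "H1_space \<Omega> = {f. \<exists>G. has_weak_gradient \<Omega> f G}"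

text \<open>A representative of the weak gradient (unique up to null sets); meaningful for
  \<open>f \<in> H1_space \<Omega>\<close> only.\<close>

definition grad :: "(real^'n) set \<Rightarrow> (real^'n \<Rightarrow> real) \<Rightarrow> real^'n \<Rightarrow> real^'n" where
  "grad \<Omega> f = (SOME G. has_weak_gradient \<Omega> f G)"

definition H10_space :: "(real^'n) set \<Rightarrow> (real^'n \<Rightarrow> real) set" where
  "H10_space \<Omega> = {f \<in> H1_space \<Omega>. \<exists>\<eta>. (\<forall>k::nat. \<eta> k \<in> test_functions \<Omega>) \<and>
     (\<lambda>k. (l2_norm \<Omega> (\<lambda>x. \<eta> k x - f x))\<^sup>2 + (l2_norm \<Omega> (\<lambda>x. grad \<Omega> (\<eta> k) x - grad \<Omega> f x))\<^sup>2)
       \<longlonglongrightarrow> 0}"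

text \<open>Row \<open>i\<close> of \<open>\<nabla>u\<close> is \<open>\<nabla>u\<^sub>i\<close>.\<close>

definition vgrad :: "(real^'n) set \<Rightarrow> (real^'n \<Rightarrow> real^'n) \<Rightarrow> real^'n \<Rightarrow> real^'n^'n" where
  "vgrad \<Omega> u x = (\<chi> i. grad \<Omega> (\<lambda>y. u y $ i) x)"

definition divergence :: "(real^'n) set \<Rightarrow> (real^'n \<Rightarrow> real^'n) \<Rightarrow> real^'n \<Rightarrow> real" where
  "divergence \<Omega> u x = trace (vgrad \<Omega> u x)"

definition convect :: "(real^'n) set \<Rightarrow> (real^'n \<Rightarrow> real^'n) \<Rightarrow> (real^'n \<Rightarrow> real) \<Rightarrow> real^'n \<Rightarrow> real" where
  "convect \<Omega> u f x = u x \<bullet> grad \<Omega> f x"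

definition vconvect ::
  "(real^'n) set \<Rightarrow> (real^'n \<Rightarrow> real^'n) \<Rightarrow> (real^'n \<Rightarrow> real^'n) \<Rightarrow> real^'n \<Rightarrow> real^'n" where
  "vconvect \<Omega> u v x = (\<chi> i. u x \<bullet> grad \<Omega> (\<lambda>y. v y $ i) x)"

text \<open>The condition \<open>interior (closure \<Omega>) = \<Omega>\<close> excludes cracks and punctures; Lipschitz regularity
  of the boundary is not required.\<close>

definition polygonal_domain :: "(real^'n) set \<Rightarrow> bool" where
  "polygonal_domain \<Omega> \<longleftrightarrow> open \<Omega> \<and> connected \<Omega> \<and> \<Omega> \<noteq> {} \<and> bounded \<Omega> \<and>
     interior (closure \<Omega>) = \<Omega> \<and>
     (\<exists>\<P>. finite \<P> \<and> (\<forall>P\<in>\<P>. polytope P) \<and> closure \<Omega> = \<Union>\<P>)"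

text \<open>The library notion \<^const>\<open>triangulation\<close> contains conformity (two elements meet in a common face).
  Elements are closed simplices of full dimension.\<close>

definition simplicial_mesh :: "(real^'n) set \<Rightarrow> (real^'n) set set \<Rightarrow> bool" where
  "simplicial_mesh \<Omega> \<T> \<longleftrightarrow> triangulation \<T> \<and> (\<forall>K\<in>\<T>. int CARD('n) simplex K) \<and>
     \<Union>\<T> = closure \<Omega>"

definition inradius :: "'a::metric_space set \<Rightarrow> real" where
  "inradius K = Sup {\<rho>. \<exists>x. cball x \<rho> \<subseteq> K}"

definition shape_regular :: "real \<Rightarrow> (real^'n) set set \<Rightarrow> bool" where
  "shape_regular \<sigma> \<T> \<longleftrightarrow> (\<forall>K\<in>\<T>. diameter K \<le> \<sigma> * inradius K)"

definition barycenter :: "(real^'n) set \<Rightarrow> real^'n" where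
  "barycenter K = (\<Sum>v | v extreme_point_of K. v) /\<^sub>R real (card {v. v extreme_point_of K})"

text \<open>For instance \<open>(d+1)\<^bsup>d+1\<^esup>\<close> times the product of the barycentric coordinates of \<open>K\<close>.\<close>

definition bubble_function :: "(real^'n) set \<Rightarrow> (real^'n \<Rightarrow> real) \<Rightarrow> bool" where
  "bubble_function K b \<longleftrightarrow> b \<in> H10_space (interior K) \<and> continuous_on K b \<and>
     (\<forall>x\<in>K. 0 \<le> b x \<and> b x \<le> 1) \<and> b (barycenter K) = 1"

text \<open>Restrictions to an element are taken on the closed simplex, so continuity up to the boundary of
  \<open>\<Omega>\<close> is no extra requirement for the piecewise functions below.\<close>

definition W_space :: "(real^'n) set \<Rightarrow> (real^'n) set set \<Rightarrow> (real^'n \<Rightarrow> real) set" where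
  "W_space \<Omega> \<T> = {\<psi>. continuous_on (closure \<Omega>) \<psi> \<and>
     (\<forall>K\<in>\<T>. \<exists>a c. \<forall>x\<in>K. \<psi> x = a \<bullet> x + c)}"

definition X_space ::
  "(real^'n) set \<Rightarrow> (real^'n) set set \<Rightarrow> ((real^'n) set \<Rightarrow> real^'n \<Rightarrow> real) \<Rightarrow> (real^'n \<Rightarrow> real^'n) set" where
  "X_space \<Omega> \<T> b = {v. continuous_on (closure \<Omega>) v \<and>
     (\<forall>i. (\<lambda>x. v x $ i) \<in> H10_space \<Omega>) \<and>
     (\<forall>K\<in>\<T>. \<forall>i. \<exists>a c \<beta>. \<forall>x\<in>K. v x $ i = a \<bullet> x + c + \<beta> * b K x)}"

definition M_space :: "(real^'n) set \<Rightarrow> (real^'n) set set \<Rightarrow> (real^'n \<Rightarrow> real) set" where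
  "M_space \<Omega> \<T> = {q \<in> W_space \<Omega> \<T>. (LINT x|lebesgue_on \<Omega>. q x) = 0}"

definition potential :: "real \<Rightarrow> real \<Rightarrow> real" where
  "potential \<epsilon> s = 1 / (4 * \<epsilon>\<^sup>2) * (1 - s\<^sup>2)\<^sup>2"

definition dpotential :: "real \<Rightarrow> real \<Rightarrow> real" where
  "dpotential \<epsilon> = deriv (potential \<epsilon>)"

definition E1 :: "(real^'n) set \<Rightarrow> real \<Rightarrow> real \<Rightarrow> (real^'n \<Rightarrow> real) \<Rightarrow> real" where
  "E1 \<Omega> \<epsilon> C\<^sub>0 \<phi> = (LINT x|lebesgue_on \<Omega>. potential \<epsilon> (\<phi> x)) + C\<^sub>0"

definition dquot :: "real \<Rightarrow> (nat \<Rightarrow> 'a \<Rightarrow> 'b::real_vector) \<Rightarrow> nat \<Rightarrow> 'a \<Rightarrow> 'b" where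
  "dquot \<Delta>t f m x = (f m x - f (m - 1) x) /\<^sub>R \<Delta>t"

definition sav_coeff ::
  "(real^'n) set \<Rightarrow> real \<Rightarrow> real \<Rightarrow> (nat \<Rightarrow> real^'n \<Rightarrow> real) \<Rightarrow> (nat \<Rightarrow> real) \<Rightarrow> nat \<Rightarrow> real" where
  "sav_coeff \<Omega> \<epsilon> C\<^sub>0 \<phi> r n = r n / sqrt (E1 \<Omega> \<epsilon> C\<^sub>0 (\<phi> n))"

definition sav_step ::
  "(real^'n) set \<Rightarrow> (real^'n) set set \<Rightarrow> ((real^'n) set \<Rightarrow> real^'n \<Rightarrow> real) \<Rightarrow> real \<Rightarrow> real \<Rightarrow> real \<Rightarrow>
   (nat \<Rightarrow> real^'n \<Rightarrow> real) \<Rightarrow> (nat \<Rightarrow> real^'n \<Rightarrow> real) \<Rightarrow> (nat \<Rightarrow> real^'n \<Rightarrow> real^'n) \<Rightarrow>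
   (nat \<Rightarrow> real^'n \<Rightarrow> real) \<Rightarrow> (nat \<Rightarrow> real) \<Rightarrow> nat \<Rightarrow> bool" where
  "sav_step \<Omega> \<T> b \<epsilon> C\<^sub>0 \<Delta>t \<phi> \<mu> u p r n \<longleftrightarrow>
     \<phi> (n + 1) \<in> W_space \<Omega> \<T> \<and> \<mu> (n + 1) \<in> W_space \<Omega> \<T> \<and> u (n + 1) \<in> X_space \<Omega> \<T> b \<and>
     p (n + 1) \<in> M_space \<Omega> \<T> \<and> r (n + 1) \<noteq> 0 \<and>
     (\<forall>\<psi>\<in>W_space \<Omega> \<T>.
        l2_inner \<Omega> (dquot \<Delta>t \<phi> (n + 1)) \<psi>
        + l2_inner \<Omega> (grad \<Omega> (\<mu> (n + 1))) (grad \<Omega> \<psi>)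
        + sav_coeff \<Omega> \<epsilon> C\<^sub>0 \<phi> r n * l2_inner \<Omega> (convect \<Omega> (u n) (\<phi> n)) \<psi> = 0) \<and>
     (\<forall>\<tau>\<in>W_space \<Omega> \<T>.
        l2_inner \<Omega> (\<mu> (n + 1)) \<tau>
        - l2_inner \<Omega> (grad \<Omega> (\<phi> (n + 1))) (grad \<Omega> \<tau>)
        - l2_inner \<Omega> (\<lambda>x. dpotential \<epsilon> (\<phi> n x)) \<tau> = 0) \<and>
     (\<forall>v\<in>X_space \<Omega> \<T> b.
        l2_inner \<Omega> (dquot \<Delta>t u (n + 1)) v
        + sav_coeff \<Omega> \<epsilon> C\<^sub>0 \<phi> r n * l2_inner \<Omega> (vconvect \<Omega> (u n) (u n)) v
        - l2_inner \<Omega> (p (n + 1)) (divergence \<Omega> v)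
        + l2_inner \<Omega> (vgrad \<Omega> (u (n + 1))) (vgrad \<Omega> v)
        - sav_coeff \<Omega> \<epsilon> C\<^sub>0 \<phi> r n * l2_inner \<Omega> (\<lambda>x. \<mu> n x *\<^sub>R grad \<Omega> (\<phi> n) x) v = 0) \<and>
     (\<forall>q\<in>M_space \<Omega> \<T>. l2_inner \<Omega> (divergence \<Omega> (u (n + 1))) q = 0) \<and>
     (r (n + 1) - r n) / \<Delta>t =
       1 / (2 * r (n + 1)) *
       (l2_inner \<Omega> (\<lambda>x. dpotential \<epsilon> (\<phi> n x)) (dquot \<Delta>t \<phi> (n + 1))
        + sav_coeff \<Omega> \<epsilon> C\<^sub>0 \<phi> r n *
          (l2_inner \<Omega> (vconvect \<Omega> (u n) (u n)) (u (n + 1))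
           + l2_inner \<Omega> (convect \<Omega> (u n) (\<phi> n)) (\<mu> (n + 1))
           - l2_inner \<Omega> (\<lambda>x. \<mu> n x *\<^sub>R grad \<Omega> (\<phi> n) x) (u (n + 1))))"

text \<open>The defining equations fix the Ritz projection only up to an additive constant, so it is a
  relation here.\<close>

definition is_ritz_projection ::
  "(real^'n) set \<Rightarrow> (real^'n) set set \<Rightarrow> (real^'n \<Rightarrow> real) \<Rightarrow> (real^'n \<Rightarrow> real) \<Rightarrow> bool" where
  "is_ritz_projection \<Omega> \<T> f f\<^sub>h \<longleftrightarrow> f\<^sub>h \<in> W_space \<Omega> \<T> \<and>
     (\<forall>\<psi>\<in>W_space \<Omega> \<T>. l2_inner \<Omega> (grad \<Omega> f\<^sub>h) (grad \<Omega> \<psi>) = l2_inner \<Omega> (grad \<Omega> f) (grad \<Omega> \<psi>))"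

definition is_L2_projection ::
  "(real^'n) set \<Rightarrow> (real^'n) set set \<Rightarrow> ((real^'n) set \<Rightarrow> real^'n \<Rightarrow> real) \<Rightarrow>
   (real^'n \<Rightarrow> real^'n) \<Rightarrow> (real^'n \<Rightarrow> real^'n) \<Rightarrow> bool" where
  "is_L2_projection \<Omega> \<T> b w w\<^sub>h \<longleftrightarrow> w\<^sub>h \<in> X_space \<Omega> \<T> b \<and>
     (\<forall>v\<in>X_space \<Omega> \<T> b. l2_inner \<Omega> w\<^sub>h v = l2_inner \<Omega> w v)"

definition sav_initial ::
  "(real^'n) set \<Rightarrow> (real^'n) set set \<Rightarrow> ((real^'n) set \<Rightarrow> real^'n \<Rightarrow> real) \<Rightarrow> real \<Rightarrow> real \<Rightarrow>
   (real^'n \<Rightarrow> real) \<Rightarrow> (real^'n \<Rightarrow> real) \<Rightarrow> (real^'n \<Rightarrow> real^'n) \<Rightarrow>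
   (nat \<Rightarrow> real^'n \<Rightarrow> real) \<Rightarrow> (nat \<Rightarrow> real^'n \<Rightarrow> real) \<Rightarrow> (nat \<Rightarrow> real^'n \<Rightarrow> real^'n) \<Rightarrow>
   (nat \<Rightarrow> real) \<Rightarrow> bool" where
  "sav_initial \<Omega> \<T> b \<epsilon> C\<^sub>0 \<phi>\<^sub>0 \<mu>\<^sub>0 u\<^sub>0 \<phi> \<mu> u r \<longleftrightarrow>
     is_ritz_projection \<Omega> \<T> \<phi>\<^sub>0 (\<phi> 0) \<and> is_ritz_projection \<Omega> \<T> \<mu>\<^sub>0 (\<mu> 0) \<and>
     is_L2_projection \<Omega> \<T> b u\<^sub>0 (u 0) \<and> r 0 = sqrt (E1 \<Omega> \<epsilon> C\<^sub>0 (\<phi> 0))"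

definition modified_energy ::
  "(real^'n) set \<Rightarrow> (nat \<Rightarrow> real^'n \<Rightarrow> real) \<Rightarrow> (nat \<Rightarrow> real^'n \<Rightarrow> real^'n) \<Rightarrow> (nat \<Rightarrow> real) \<Rightarrow> nat \<Rightarrow> real" where
  "modified_energy \<Omega> \<phi> u r n =
     (LINT x|lebesgue_on \<Omega>. 1 / 2 * ((norm (u n x))\<^sup>2 + (norm (grad \<Omega> (\<phi> n) x))\<^sup>2)) + \<bar>r n\<bar>\<^sup>2"

end

theory Submission
  imports Defs
begin

text \<open>Testing the four variational equations with \<open>\<mu>\<^bsup>n+1\<^esup>\<close>, \<open>d\<^sub>t\<phi>\<^bsup>n+1\<^esup>\<close>, \<open>u\<^bsup>n+1\<^esup>\<close>, \<open>p\<^bsup>n+1\<^esup>\<close> and multiplying the equation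
  for \<open>r\<^bsup>n+1\<^esup>\<close> by \<open>2r\<^bsup>n+1\<^esup>\<close>, all nonlinear terms cancel; \<open>2a(a - b) \<ge> a\<^sup>2 - b\<^sup>2\<close> then gives the estimate.
  The analytic content is that \<open>\<nabla>d\<^sub>t\<phi>\<^bsup>n+1\<^esup>\<close> may be expanded by linearity, although \<^const>\<open>grad\<close> is only a chosen
  representative. This needs almost everywhere uniqueness of weak gradients, from the fundamental lemma of the
  calculus of variations (smooth bumps approximate boxes, and Lebesgue differentiation concludes), and it needs
  continuous piecewise affine functions to lie in \<open>H\<^sup>1\<close>. For the latter, integration by parts is summation by
  parts for difference quotients, passed to the limit by dominated convergence.\<close>


subsection \<open>Smooth bump functions\<close>

text \<open>\<open>Ck\<close> recurses through \<open>frechet_derivative\<close>, which is a choice.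
  Uniqueness of derivatives lets any explicit candidate \<open>f'\<close> take its place, and all
  later smoothness proofs enter here.\<close>

lemma Ck_SucI:
  assumes "\<And>x. (f has_derivative f' x) (at x)" and "\<And>v. Ck k (\<lambda>x. f' x v)"
  shows "Ck (Suc k) f"
proof -
  have "frechet_derivative f (at x) = f' x" for x
    using frechet_derivative_at[OF assms(1)[of x]] by simp
  then show ?thesis
    using assms by (auto simp: differentiable_def)
qed

lemma Ck_SucD:
  assumes "Ck (Suc k) f"
  shows "(f has_derivative frechet_derivative f (at x)) (at x)"
    and "Ck k (\<lambda>x. frechet_derivative f (at x) v)"
  using assms by (auto simp: frechet_derivative_works)

lemma Ck_continuous:
  assumes "Ck k f"
  shows "continuous_on UNIV f"
proof (cases k)
  case (Suc j)
  with assms have "(f has_derivative frechet_derivative f (at x)) (at x)" for x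
    using Ck_SucD(1) by blast
  then show ?thesis
    by (meson continuous_at_imp_continuous_on has_derivative_continuous)
qed (use assms in auto)

text \<open>For the product rule: each summand of the derivative of a product keeps one factor
  undifferentiated, and that factor must be lowered by one class before the induction hypothesis
  applies.\<close>

lemma Ck_pred: "Ck (Suc k) f \<Longrightarrow> Ck k f"
proof (induction k arbitrary: f)
  case 0
  then show ?case using Ck_continuous[OF 0] by simp
next
  case (Suc k)
  show ?case
    by (rule Ck_SucI[OF Ck_SucD(1)[OF Suc.prems]]) (use Suc.IH Ck_SucD(2)[OF Suc.prems] in blast)
qed

lemma Ck_const: "Ck k (\<lambda>x. c)"
proof (induction k arbitrary: c)
  case (Suc k)
  show ?case
    by (rule Ck_SucI[of _ "\<lambda>_ _. 0"]) (auto intro: Suc)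
qed auto

lemma Ck_add: "Ck k f \<Longrightarrow> Ck k g \<Longrightarrow> Ck k (\<lambda>x. f x + g x)"
proof (induction k arbitrary: f g)
  case 0
  then show ?case by (auto intro: continuous_intros)
next
  case (Suc k)
  show ?case
    by (rule Ck_SucI[OF has_derivative_add[OF Ck_SucD(1) Ck_SucD(1)]])
      (use Suc.prems in \<open>auto intro!: Suc.IH\<close>)
qed

lemma Ck_mult: "Ck k f \<Longrightarrow> Ck k g \<Longrightarrow> Ck k (\<lambda>x. f x * g x)"
proof (induction k arbitrary: f g)
  case 0
  then show ?case by (auto intro: continuous_intros)
next
  case (Suc k)
  show ?case
    by (rule Ck_SucI[OF has_derivative_mult[OF Ck_SucD(1) Ck_SucD(1)]])
      (use Suc.prems Ck_pred in \<open>auto intro!: Suc.IH Ck_add\<close>)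
qed

lemma Ck_prod: "(\<And>i. i \<in> I \<Longrightarrow> Ck k (f i)) \<Longrightarrow> Ck k (\<lambda>x. \<Prod>i\<in>I. f i x)"
  by (induction I rule: infinite_finite_induct) (auto intro!: Ck_mult Ck_const)

text \<open>The classical flat function exp(-c/t), extended by zero. The polynomial factor in 1/t
  makes the family closed under differentiation; the rate \<open>c\<close> stays free because c -> 0
  produces the Heaviside step.\<close>

definition flat :: "real poly \<Rightarrow> real \<Rightarrow> real \<Rightarrow> real" where
  "flat P c t = (if t > 0 then poly P (1 / t) * exp (- (c / t)) else 0)"

text \<open>Substituting s = 1/t turns the right-hand limit into the decay of s^k exp(-c s) at
  infinity, monomial by monomial; to the left of 0 the function vanishes.\<close>

lemma flat_tendsto_0:
  assumes "c > 0"
  shows "(flat P c \<longlongrightarrow> 0) (at 0)"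
proof -
  have "((\<lambda>s. s ^ k * exp (- (c * s))) \<longlongrightarrow> 0) at_top" for k
  proof -
    have "((\<lambda>s. (c * s) ^ k / exp (c * s)) \<longlongrightarrow> 0) at_top"
      using filterlim_compose[OF tendsto_power_div_exp_0]
        filterlim_tendsto_pos_mult_at_top[OF tendsto_const assms filterlim_ident] by blast
    from tendsto_mult[OF tendsto_const[of "1 / c ^ k"] this]
    show ?thesis
      using assms by (simp add: power_mult_distrib exp_minus field_simps)
  qed
  then have "((\<lambda>s. \<Sum>k\<le>degree P. coeff P k * (s ^ k * exp (- (c * s)))) \<longlongrightarrow> 0) at_top"
    by (intro tendsto_null_sum tendsto_mult_right_zero)
  then have "((\<lambda>s. poly P s * exp (- (c * s))) \<longlongrightarrow> 0) at_top"
    by (simp add: poly_altdef sum_distrib_right mult.assoc)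
  from filterlim_compose[OF this filterlim_inverse_at_top_right]
  have "((\<lambda>t. poly P (inverse t) * exp (- (c * inverse t))) \<longlongrightarrow> 0) (at_right 0)" .
  then have "(flat P c \<longlongrightarrow> 0) (at_right 0)"
    by (rule Lim_transform_eventually)
      (auto simp: eventually_at_right_less flat_def divide_inverse
        intro: eventually_mono[OF eventually_at_right_less])
  moreover have "(flat P c \<longlongrightarrow> 0) (at_left 0)"
    by (rule Lim_transform_eventually[OF tendsto_const])
      (auto simp: flat_def eventually_at intro: exI[of _ 1])
  ultimately show ?thesis
    by (simp add: filterlim_split_at_real)
qed

text \<open>For t > 0 the chain rule gives (c P(1/t) - P'(1/t)) exp(-c/t) / t^2, and the factor
  1/t^2 is the polynomial \<open>[:0, 0, 1:]\<close> evaluated at 1/t.\<close>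

lemma has_real_derivative_flat:
  assumes "c > 0"
  shows "(flat P c has_real_derivative flat ([:0, 0, 1:] * (smult c P - pderiv P)) c t) (at t)"
proof -
  consider "t > 0" | "t < 0" | "t = 0" by linarith
  then show ?thesis
  proof cases
    case 1
    have "((\<lambda>t. poly P (1 / t) * exp (- (c / t))) has_real_derivative
        flat ([:0, 0, 1:] * (smult c P - pderiv P)) c t) (at t)"
      using 1 by (auto intro!: derivative_eq_intros poly_DERIV[THEN DERIV_chain2] simp: flat_def field_simps power2_eq_square)
    then show ?thesis
      by (rule has_field_derivative_transform_within_open[of _ _ _ "{0<..}"])
        (use 1 in \<open>auto simp: flat_def\<close>)
  next
    case 2
    have "((\<lambda>t. 0) has_real_derivative 0) (at t)" by simp
    then have "(flat P c has_real_derivative 0) (at t)"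
      by (rule has_field_derivative_transform_within_open[of _ _ _ "{..<0}"])
        (use 2 in \<open>auto simp: flat_def\<close>)
    then show ?thesis using 2 by (simp add: flat_def)
  next
    case 3
    \<comment> \<open>Dividing by h multiplies the polynomial in 1/h by its variable, so the
      difference quotient at 0 is again a flat function and tends to 0.\<close>
    have "(\<lambda>h. (flat P c (0 + h) - flat P c 0) / h) = flat (pCons 0 P) c"
      by (auto simp: flat_def)
    then have "(flat P c has_real_derivative 0) (at 0)"
      using flat_tendsto_0[OF assms, of "pCons 0 P"] by (simp add: DERIV_def)
    then show ?thesis using 3 by (simp add: flat_def)
  qed
qed

text \<open>Differentiation reproduces a flat function with another polynomial, hence the induction
  over \<open>k\<close> with \<open>P\<close> arbitrary.\<close>

lemma Ck_flat:
  fixes l :: "'a::real_inner"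
  assumes "c > 0"
  shows "Ck k (\<lambda>x. flat P c (l \<bullet> x + d))"
proof (induction k arbitrary: P)
  case 0
  have "continuous_on UNIV (flat P c)"
    by (rule DERIV_continuous_on[OF has_field_derivative_at_within[OF has_real_derivative_flat[OF assms]]])
  then show ?case
    by (auto intro!: continuous_on_compose2[of UNIV "flat P c"] continuous_intros)
next
  case (Suc k)
  let ?Q = "[:0, 0, 1:] * (smult c P - pderiv P)"
  show ?case
  proof (rule Ck_SucI)
    fix x
    have "((\<lambda>x. l \<bullet> x + d) has_derivative (\<lambda>v. l \<bullet> v)) (at x)"
      by (auto intro!: derivative_eq_intros)
    from DERIV_compose_FDERIV[OF has_real_derivative_flat[OF assms] this]
    show "((\<lambda>x. flat P c (l \<bullet> x + d)) has_derivative (\<lambda>v. (l \<bullet> v) * flat ?Q c (l \<bullet> x + d))) (at x)" .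
  next
    fix v
    show "Ck k (\<lambda>x. (l \<bullet> v) * flat ?Q c (l \<bullet> x + d))"
      by (intro Ck_mult Ck_const Suc)
  qed
qed

text \<open>Two flat factors per coordinate switch the product off on either side of the box. Their
  arguments are written in the form \<open>l \<bullet> x + d\<close> of
  \<open>Ck_flat\<close>.\<close>

definition box_bump :: "real \<Rightarrow> 'a::euclidean_space \<Rightarrow> 'a \<Rightarrow> 'a \<Rightarrow> real" where
  "box_bump c a b x = (\<Prod>i\<in>Basis. flat 1 c (i \<bullet> x + - (a \<bullet> i)) * flat 1 c (- i \<bullet> x + b \<bullet> i))"

lemma box_bump_test_function:
  assumes "c > 0" "cbox a b \<subseteq> \<Omega>"
  shows "box_bump c a b \<in> test_functions \<Omega>"
proof -
  have "Ck k (box_bump c a b)" for k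
    unfolding box_bump_def[abs_def] by (intro Ck_prod Ck_mult Ck_flat assms)
  moreover have "x \<in> cbox a b" if "box_bump c a b x \<noteq> 0" for x
    unfolding mem_box
  proof
    fix i :: 'a
    assume "i \<in> Basis"
    with that have "flat 1 c (i \<bullet> x + - (a \<bullet> i)) \<noteq> 0" "flat 1 c (- i \<bullet> x + b \<bullet> i) \<noteq> 0"
      by (auto simp: box_bump_def)
    then show "a \<bullet> i \<le> x \<bullet> i \<and> x \<bullet> i \<le> b \<bullet> i"
      by (auto simp: flat_def inner_commute[of i x] split: if_splits)
  qed
  then have "closure {x. box_bump c a b x \<noteq> 0} \<subseteq> cbox a b"
    by (intro closure_minimal) auto
  moreover from this have "compact (closure {x. box_bump c a b x \<noteq> 0})"
    using bounded_subset[OF bounded_cbox] by (simp add: compact_eq_bounded_closed)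
  ultimately show ?thesis
    using assms(2) by (auto simp: test_functions_def)
qed

lemma flat_1_range: "c > 0 \<Longrightarrow> flat 1 c t \<in> {0..1}"
  by (auto simp: flat_def)

lemma box_bump_range:
  assumes "c > 0"
  shows "box_bump c a b x \<in> {0..1}"
proof -
  have "flat 1 c s * flat 1 c t \<in> {0..1}" for s t
    using flat_1_range[OF assms, of s] flat_1_range[OF assms, of t] by (auto intro: mult_le_one)
  then show ?thesis
    unfolding box_bump_def by (auto intro: prod_nonneg prod_le_1)
qed

text \<open>As c = 1/(k+1) tends to 0, exp(-c/t) tends to 1 for t > 0, while the value for t \<le> 0
  is always 0; the finite product of these steps is the indicator of the open box.\<close>

lemma box_bump_tendsto:
  "(\<lambda>k. box_bump (1 / real (Suc k)) a b x) \<longlonglongrightarrow> indicator (box a b) x"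
proof -
  have flat: "(\<lambda>k. flat 1 (1 / real (Suc k)) t) \<longlonglongrightarrow> of_bool (t > 0)" for t
  proof (cases "t > 0")
    case True
    have "(\<lambda>k. exp (- (1 / real (Suc k) / t))) \<longlonglongrightarrow> exp (- (0 / t))"
      using True by (intro tendsto_intros LIMSEQ_Suc lim_const_over_n) auto
    then show ?thesis using True by (simp add: flat_def)
  qed (simp add: flat_def)
  have "(\<Prod>i\<in>Basis. of_bool (i \<bullet> x + - (a \<bullet> i) > 0) * of_bool (- i \<bullet> x + b \<bullet> i > 0)) = indicat_real (box a b) x"
  proof (cases "x \<in> box a b")
    case True
    then show ?thesis by (auto simp: mem_box inner_commute intro!: prod.neutral)
  next
    case False
    then obtain i where "i \<in> Basis" "\<not> (a \<bullet> i < x \<bullet> i \<and> x \<bullet> i < b \<bullet> i)"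
      by (auto simp: mem_box)
    then show ?thesis
      using False by (auto simp: inner_commute intro!: prod_zero bexI[of _ i])
  qed
  moreover have "(\<lambda>k. box_bump (1 / real (Suc k)) a b x) \<longlonglongrightarrow>
      (\<Prod>i\<in>Basis. of_bool (i \<bullet> x + - (a \<bullet> i) > 0) * of_bool (- i \<bullet> x + b \<bullet> i > 0))"
    unfolding box_bump_def by (intro tendsto_prod tendsto_mult flat)
  ultimately show ?thesis by simp
qed

subsection \<open>Test functions and the fundamental lemma\<close>

lemma test_function_Ck: "\<eta> \<in> test_functions \<Omega> \<Longrightarrow> Ck k \<eta>"
  by (simp add: test_functions_def)

lemma test_function_has_derivative:
  "\<eta> \<in> test_functions \<Omega> \<Longrightarrow> (\<eta> has_derivative frechet_derivative \<eta> (at x)) (at x)"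
  using Ck_SucD(1)[OF test_function_Ck[of \<eta> \<Omega> "Suc 0"]] .

lemma test_function_continuous: "\<eta> \<in> test_functions \<Omega> \<Longrightarrow> continuous_on UNIV \<eta>"
  using Ck_continuous test_function_Ck by blast

lemma test_function_measurable: "\<eta> \<in> test_functions \<Omega> \<Longrightarrow> \<eta> \<in> borel_measurable (lebesgue_on \<Omega>)"
  using borel_measurable_continuous_onI[OF test_function_continuous]
  by (intro measurable_restrict_space1 measurable_completion) auto

text \<open>Off its closed support the function is locally zero, so its derivative vanishes there
  and the support cannot grow.\<close>

lemma test_function_derivative:
  assumes \<eta>: "\<eta> \<in> test_functions \<Omega>"
  shows "(\<lambda>x. frechet_derivative \<eta> (at x) v) \<in> test_functions \<Omega>"
proof -
  let ?S = "closure {x. \<eta> x \<noteq> 0}"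
  have "frechet_derivative \<eta> (at x) v = 0" if "x \<notin> ?S" for x
  proof -
    have "((\<lambda>x. 0::real) has_derivative (\<lambda>v. 0)) (at x)" by simp
    moreover have "open (- ?S)" by auto
    ultimately have "(\<eta> has_derivative (\<lambda>v. 0)) (at x)"
      by (rule has_derivative_transform_within_open)
        (use that closure_subset[of "{x. \<eta> x \<noteq> 0}"] in auto)
    from frechet_derivative_at[OF this] show ?thesis by (metis)
  qed
  then have sub: "closure {x. frechet_derivative \<eta> (at x) v \<noteq> 0} \<subseteq> ?S"
    by (intro closure_minimal) auto
  moreover have "compact (closure {x. frechet_derivative \<eta> (at x) v \<noteq> 0})"
    using bounded_subset[OF _ sub] \<eta> by (simp add: test_functions_def compact_eq_bounded_closed)
  ultimately show ?thesis
    using \<eta> Ck_SucD(2)[OF test_function_Ck[OF \<eta>]] by (auto simp: test_functions_def)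
qed

lemma test_function_bounded:
  assumes "\<eta> \<in> test_functions \<Omega>"
  obtains B where "B \<ge> 0" "\<And>x. \<bar>\<eta> x\<bar> \<le> B"
proof -
  let ?S = "closure {x. \<eta> x \<noteq> 0}"
  have "bounded (\<eta> ` ?S)"
    using assms compact_continuous_image[of ?S \<eta>] continuous_on_subset[OF test_function_continuous[OF assms]]
    by (auto simp: test_functions_def intro: compact_imp_bounded)
  then obtain B where B: "B > 0" "\<And>x. x \<in> ?S \<Longrightarrow> \<bar>\<eta> x\<bar> \<le> B"
    by (auto simp: bounded_pos)
  have "\<bar>\<eta> x\<bar> \<le> B" for x
    using B closure_subset[of "{x. \<eta> x \<noteq> 0}"] by (cases "\<eta> x = 0") auto
  with B(1) show ?thesis by (intro that[of B]) auto
qed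

lemma integrable_mult_test_function:
  assumes "integrable (lebesgue_on \<Omega>) f" "\<eta> \<in> test_functions \<Omega>"
  shows "integrable (lebesgue_on \<Omega>) (\<lambda>x. f x * \<eta> x)"
proof -
  obtain B where B: "B \<ge> 0" "\<And>x. \<bar>\<eta> x\<bar> \<le> B" using test_function_bounded[OF assms(2)] by blast
  have [measurable]: "\<eta> \<in> borel_measurable (lebesgue_on \<Omega>)" "f \<in> borel_measurable (lebesgue_on \<Omega>)"
    using assms test_function_measurable by auto
  show ?thesis
  proof (rule Bochner_Integration.integrable_bound)
    show "integrable (lebesgue_on \<Omega>) (\<lambda>x. B * f x)" using assms by simp
    show "AE x in lebesgue_on \<Omega>. norm (f x * \<eta> x) \<le> norm (B * f x)"
      using B by (auto simp: abs_mult mult.commute intro!: AE_I2 mult_right_mono)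
  qed measurable
qed

lemma fundamental_lemma_calculus_of_variations:
  fixes \<Omega> :: "'a::euclidean_space set"
  assumes \<Omega>: "open \<Omega>" and D: "integrable (lebesgue_on \<Omega>) D"
    and orth: "\<And>\<eta>. \<eta> \<in> test_functions \<Omega> \<Longrightarrow> (LINT x|lebesgue_on \<Omega>. D x * \<eta> x) = 0"
  shows "AE x in lebesgue_on \<Omega>. D x = 0"
proof -
  have \<Omega>l: "\<Omega> \<in> sets lebesgue" using \<Omega> by (simp add: lborelD)
  have [measurable]: "D \<in> borel_measurable (lebesgue_on \<Omega>)" using D by auto
  \<comment> \<open>Extension by zero, since the differentiation theorem used below needs
    integrability on every box of the whole space.\<close>
  define D' where "D' = (\<lambda>x. if x \<in> \<Omega> then D x else 0)"
  have "D integrable_on \<Omega>"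
    using has_integral_integral_lebesgue_on[OF D \<Omega>l] by blast
  then have "D' integrable_on UNIV"
    unfolding D'_def by (simp add: integrable_restrict_UNIV)
  then have int: "D' integrable_on cbox a b" for a b
    using integrable_on_subcbox by blast
  have zero: "integral (cbox a b) D' = 0" if sub: "cbox a b \<subseteq> \<Omega>" for a b
  proof -
    have "box a b \<in> sets (lebesgue_on \<Omega>)"
      using sub \<Omega>l box_subset_cbox[of a b] by (auto simp: sets_restrict_space_iff)
    then have int_box: "integrable (lebesgue_on \<Omega>) (\<lambda>x. D x * indicator (box a b) x)"
      by (rule integrable_real_mult_indicator[OF _ D])
    \<comment> \<open>Bumps take values in [0,1], so \<open>\<bar>D x\<bar>\<close> dominates; each
      integral on the left is zero by \<open>orth\<close>.\<close>
    have "(\<lambda>k. LINT x|lebesgue_on \<Omega>. D x * box_bump (1 / real (Suc k)) a b x)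
        \<longlonglongrightarrow> (LINT x|lebesgue_on \<Omega>. D x * indicator (box a b) x)"
    proof (rule integral_dominated_convergence)
      show "integrable (lebesgue_on \<Omega>) (\<lambda>x. \<bar>D x\<bar>)" using D by simp
      show "AE x in lebesgue_on \<Omega>. (\<lambda>k. D x * box_bump (1 / real (Suc k)) a b x)
          \<longlonglongrightarrow> D x * indicator (box a b) x"
        by (intro AE_I2 tendsto_intros box_bump_tendsto)
      show "AE x in lebesgue_on \<Omega>. norm (D x * box_bump (1 / real (Suc k)) a b x) \<le> \<bar>D x\<bar>" for k
        using box_bump_range[of "1 / real (Suc k)" a b]
        by (auto simp: abs_mult intro!: AE_I2 mult_left_le)
      show "(\<lambda>x. D x * box_bump (1 / real (Suc k)) a b x) \<in> borel_measurable (lebesgue_on \<Omega>)" for k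
        by (intro borel_measurable_times test_function_measurable[OF box_bump_test_function[OF _ sub]]) auto
    qed (use int_box in auto)
    moreover have "(LINT x|lebesgue_on \<Omega>. D x * box_bump (1 / real (Suc k)) a b x) = 0" for k
      by (intro orth box_bump_test_function sub) auto
    ultimately have 0: "(LINT x|lebesgue_on \<Omega>. D x * indicator (box a b) x) = 0"
      by (simp add: LIMSEQ_const_iff)
    from lebesgue_integral_eq_integral[OF int_box \<Omega>l] 0
    have "integral \<Omega> (\<lambda>x. D x * indicator (box a b) x) = 0" by simp
    also have "integral \<Omega> (\<lambda>x. D x * indicator (box a b) x) = integral (box a b) D'"
      unfolding integral_restrict_UNIV[of \<Omega>, symmetric] integral_restrict_UNIV[of "box a b", symmetric]
      by (intro arg_cong[where f = "integral UNIV"])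
        (auto simp: D'_def indicator_def fun_eq_iff)
    finally show ?thesis by (simp add: integral_open_interval)
  qed
  \<comment> \<open>Lebesgue differentiation: outside \<open>N\<close>, averages over shrinking
    cubes with corner x converge to \<open>D' x\<close>.\<close>
  obtain N where N: "negligible N" and lim: "\<And>x e. \<lbrakk>x \<notin> N; 0 < e\<rbrakk> \<Longrightarrow>
      \<exists>d>0. \<forall>h. 0 < h \<and> h < d \<longrightarrow> norm (integral (cbox x (x + h *\<^sub>R One)) D' /\<^sub>R h ^ DIM('a) - D' x) < e"
    using integrable_ccontinuous_explicit[of D', OF int] by metis
  have "D x = 0" if x: "x \<in> \<Omega>" "x \<notin> N" for x
  proof (rule ccontr)
    \<comment> \<open>Take the tolerance to be \<open>\<bar>D x\<bar>\<close> itself. A vanishing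
      average misses \<open>D x\<close> by exactly this amount, contradicting the strict
      bound.\<close>
    assume "D x \<noteq> 0"
    then obtain d where d: "d > 0"
      "\<And>h. 0 < h \<and> h < d \<Longrightarrow> norm (integral (cbox x (x + h *\<^sub>R One)) D' /\<^sub>R h ^ DIM('a) - D' x) < \<bar>D x\<bar>"
      using lim[OF x(2), of "\<bar>D x\<bar>"] by auto
    obtain \<rho> where \<rho>: "\<rho> > 0" "ball x \<rho> \<subseteq> \<Omega>"
      using \<Omega> x(1) open_contains_ball by blast
    \<comment> \<open>The first entry keeps h below d; the second makes the l1 size h * DIM of the
      cube less than \<rho>, so the cube stays in the ball.\<close>
    define h where "h = min (d / 2) (\<rho> / (2 * real DIM('a)))"
    have h: "0 < h" "h < d" "h * real DIM('a) < \<rho>"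
      using d(1) \<rho>(1) by (auto simp: h_def min_def field_simps)
    have "cbox x (x + h *\<^sub>R One) \<subseteq> ball x \<rho>"
    proof
      fix y assume y: "y \<in> cbox x (x + h *\<^sub>R One)"
      have "dist x y = norm (y - x)" by (simp add: dist_norm norm_minus_commute)
      also have "\<dots> \<le> (\<Sum>i\<in>Basis. \<bar>(y - x) \<bullet> i\<bar>)" by (rule norm_le_l1)
      also have "\<dots> \<le> (\<Sum>i\<in>(Basis::'a set). h)"
        using y by (intro sum_mono) (auto simp: mem_box inner_diff_left inner_add_left)
      finally show "y \<in> ball x \<rho>" using h(3) by (simp add: mult.commute)
    qed
    with \<rho>(2) have "integral (cbox x (x + h *\<^sub>R One)) D' = 0" by (intro zero) auto
    with d(2)[of h] h x(1) show False by (simp add: D'_def)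
  qed
  moreover have "AE x in lebesgue_on \<Omega>. x \<notin> N"
    using N \<Omega>l by (auto simp: AE_restrict_space_iff negligible_iff_null_sets intro: AE_not_in eventually_mono)
  ultimately show ?thesis
    by (auto elim!: eventually_mono[rotated] simp: AE_restrict_space_iff \<Omega>l)
qed

subsection \<open>Weak gradients\<close>

lemma L2_measurable: "f \<in> L2_space \<Omega> \<Longrightarrow> f \<in> borel_measurable (lebesgue_on \<Omega>)"
  by (simp add: L2_space_def)

text \<open>Cauchy-Schwarz and 2ab \<le> a^2 + b^2 bound the integrand by the sum of the two squared
  norms.\<close>

lemma L2_inner_integrable:
  assumes "f \<in> L2_space \<Omega>" "g \<in> L2_space \<Omega>"
  shows "integrable (lebesgue_on \<Omega>) (\<lambda>x. f x \<bullet> g x)"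
proof (rule Bochner_Integration.integrable_bound)
  show "integrable (lebesgue_on \<Omega>) (\<lambda>x. (norm (f x))\<^sup>2 + (norm (g x))\<^sup>2)"
    using assms by (simp add: L2_space_def)
  show "(\<lambda>x. f x \<bullet> g x) \<in> borel_measurable (lebesgue_on \<Omega>)"
    using assms by (intro borel_measurable_inner L2_measurable)
  have "\<bar>f x \<bullet> g x\<bar> \<le> (norm (f x))\<^sup>2 + (norm (g x))\<^sup>2" for x
    using Cauchy_Schwarz_ineq2[of "f x" "g x"] sum_squares_bound[of "norm (f x)" "norm (g x)"]
      mult_nonneg_nonneg[of "norm (f x)" "norm (g x)"]
    by (simp only: mult.assoc norm_ge_zero)
  then show "AE x in lebesgue_on \<Omega>. norm (f x \<bullet> g x) \<le> norm ((norm (f x))\<^sup>2 + (norm (g x))\<^sup>2)"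
    by (intro AE_I2) simp
qed

text \<open>Expanding the squared norm leaves only inner products, all integrable by
  \<open>L2_inner_integrable\<close>.\<close>

lemma L2_lincomb:
  assumes "f \<in> L2_space \<Omega>" "g \<in> L2_space \<Omega>"
  shows "(\<lambda>x. a *\<^sub>R f x + b *\<^sub>R g x) \<in> L2_space \<Omega>"
proof -
  have "(norm (a *\<^sub>R f x + b *\<^sub>R g x))\<^sup>2 = a\<^sup>2 * (f x \<bullet> f x) + 2 * a * b * (f x \<bullet> g x) + b\<^sup>2 * (g x \<bullet> g x)" for x
    unfolding power2_norm_eq_inner inner_add_left inner_add_right inner_commute[of "g x" "f x"] inner_scaleR_left inner_scaleR_right
    by (simp add: power2_eq_square algebra_simps)
  moreover have "integrable (lebesgue_on \<Omega>)
      (\<lambda>x. a\<^sup>2 * (f x \<bullet> f x) + 2 * a * b * (f x \<bullet> g x) + b\<^sup>2 * (g x \<bullet> g x))"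
    using assms by (intro Bochner_Integration.integrable_add integrable_mult_right L2_inner_integrable)
  moreover have "(\<lambda>x. a *\<^sub>R f x + b *\<^sub>R g x) \<in> borel_measurable (lebesgue_on \<Omega>)"
    using assms by (intro borel_measurable_add borel_measurable_scaleR borel_measurable_const L2_measurable)
  ultimately show ?thesis
    by (simp only: L2_space_def mem_Collect_eq)
qed

text \<open>On a set of finite measure 1 + |f|^2 is integrable and dominates |f|.\<close>

lemma L2_integrable:
  assumes "\<Omega> \<in> lmeasurable" "f \<in> L2_space \<Omega>"
  shows "integrable (lebesgue_on \<Omega>) f"
proof (rule Bochner_Integration.integrable_bound)
  have 1: "integrable (lebesgue_on \<Omega>) (\<lambda>x. (norm (f x))\<^sup>2)"
    using assms(2) by (simp add: L2_space_def)
  have 2: "integrable (lebesgue_on \<Omega>) (\<lambda>x. 1::real)"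
    by (rule finite_measure.integrable_const[OF finite_measure_lebesgue_on[OF assms(1)]])
  show "integrable (lebesgue_on \<Omega>) (\<lambda>x. 1 + (norm (f x))\<^sup>2)"
    by (rule Bochner_Integration.integrable_add[OF 2 1])
  show "f \<in> borel_measurable (lebesgue_on \<Omega>)"
    using assms(2) by (simp add: L2_space_def)
  have "norm (f x) \<le> 1 + (norm (f x))\<^sup>2" for x
    using sum_squares_bound[of 1 "norm (f x)"] norm_ge_zero[of "f x"] unfolding power_one by linarith
  then show "AE x in lebesgue_on \<Omega>. norm (f x) \<le> norm (1 + (norm (f x))\<^sup>2)"
    by (intro AE_I2) simp
qed

lemma bounded_imp_L2:
  assumes "\<Omega> \<in> lmeasurable" "f \<in> borel_measurable (lebesgue_on \<Omega>)" "\<And>x. x \<in> \<Omega> \<Longrightarrow> norm (f x) \<le> B"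
  shows "f \<in> L2_space \<Omega>"
proof -
  have "AE x in lebesgue_on \<Omega>. norm ((norm (f x))\<^sup>2) \<le> B\<^sup>2"
    using assms(3) by (intro AE_I2) (auto intro!: power_mono)
  then have "integrable (lebesgue_on \<Omega>) (\<lambda>x. (norm (f x))\<^sup>2)"
    using assms(2)
    by (intro finite_measure.integrable_const_bound[OF finite_measure_lebesgue_on[OF assms(1)]]
        borel_measurable_power measurable_compose[OF _ borel_measurable_norm])
  then show ?thesis using assms(2) by (simp add: L2_space_def)
qed

section \<open>Weak gradients: linearity and almost everywhere uniqueness\<close>

lemma has_weak_gradientD:
  assumes "has_weak_gradient \<Omega> f G"
  shows "f \<in> L2_space \<Omega>" "G \<in> L2_space \<Omega>"
    and "\<eta> \<in> test_functions \<Omega> \<Longrightarrow> (LINT x|lebesgue_on \<Omega>. f x * frechet_derivative \<eta> (at x) (axis i 1)) =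
        - (LINT x|lebesgue_on \<Omega>. G x $ i * \<eta> x)"
  using assms unfolding has_weak_gradient_def by simp_all

lemma integrable_vec_nth:
  "integrable M f \<Longrightarrow> integrable M (\<lambda>x. f x $ i :: real)"
  by (rule integrable_bounded_linear[OF bounded_linear_vec_nth])

text \<open>Linearity holds for the relation; \<open>grad\<close>, being a choice, inherits it only
  almost everywhere.\<close>

lemma has_weak_gradient_lincomb:
  assumes \<Omega>: "\<Omega> \<in> lmeasurable" and f: "has_weak_gradient \<Omega> f F" and g: "has_weak_gradient \<Omega> g G"
  shows "has_weak_gradient \<Omega> (\<lambda>x. a *\<^sub>R f x + b *\<^sub>R g x) (\<lambda>x. a *\<^sub>R F x + b *\<^sub>R G x)"
  unfolding has_weak_gradient_def
proof (intro conjI ballI allI L2_lincomb)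
  fix \<eta> i assume \<eta>: "\<eta> \<in> test_functions \<Omega>"
  let ?d = "\<lambda>x. frechet_derivative \<eta> (at x) (axis i 1)"
  note L2 = has_weak_gradientD(1,2)[OF f] has_weak_gradientD(1,2)[OF g]
  note L2_int = L2[THEN L2_integrable[OF \<Omega>]]
  note int = integrable_mult_test_function[OF L2_int(1) test_function_derivative[OF \<eta>]]
    integrable_mult_test_function[OF L2_int(3) test_function_derivative[OF \<eta>]]
    integrable_mult_test_function[OF integrable_vec_nth[OF L2_int(2)] \<eta>]
    integrable_mult_test_function[OF integrable_vec_nth[OF L2_int(4)] \<eta>]
  have "(LINT x|lebesgue_on \<Omega>. (a *\<^sub>R f x + b *\<^sub>R g x) * ?d x) =
      (LINT x|lebesgue_on \<Omega>. a * (f x * ?d x) + b * (g x * ?d x))"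
    by (simp only: real_scaleR_def distrib_right mult.assoc)
  also have "\<dots> = a * (LINT x|lebesgue_on \<Omega>. f x * ?d x) + b * (LINT x|lebesgue_on \<Omega>. g x * ?d x)"
    by (simp only: Bochner_Integration.integral_add integral_mult_right_zero integrable_mult_right int)
  also have "\<dots> = - (a * (LINT x|lebesgue_on \<Omega>. F x $ i * \<eta> x) + b * (LINT x|lebesgue_on \<Omega>. G x $ i * \<eta> x))"
    by (simp only: has_weak_gradientD(3)[OF f \<eta>] has_weak_gradientD(3)[OF g \<eta>] mult_minus_right minus_add_distrib)
  also have "a * (LINT x|lebesgue_on \<Omega>. F x $ i * \<eta> x) + b * (LINT x|lebesgue_on \<Omega>. G x $ i * \<eta> x) =
      (LINT x|lebesgue_on \<Omega>. a * (F x $ i * \<eta> x) + b * (G x $ i * \<eta> x))"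
    by (simp only: Bochner_Integration.integral_add integral_mult_right_zero integrable_mult_right int)
  finally show "(LINT x|lebesgue_on \<Omega>. (a *\<^sub>R f x + b *\<^sub>R g x) * ?d x) =
      - (LINT x|lebesgue_on \<Omega>. (a *\<^sub>R F x + b *\<^sub>R G x) $ i * \<eta> x)"
    by (simp only: vector_add_component vector_scaleR_component real_scaleR_def distrib_right mult.assoc)
qed (intro has_weak_gradientD(1,2)[OF f] has_weak_gradientD(1,2)[OF g])+

text \<open>Each component of the difference is orthogonal to all test functions, hence zero almost
  everywhere; finitely many components give finitely many null sets.\<close>

lemma weak_gradient_unique:
  assumes \<Omega>: "open \<Omega>" "bounded \<Omega>" and F: "has_weak_gradient \<Omega> f F" and G: "has_weak_gradient \<Omega> f G"
  shows "AE x in lebesgue_on \<Omega>. F x = G x"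
proof -
  have lm: "\<Omega> \<in> lmeasurable" by (rule lmeasurable_open[OF \<Omega>(2,1)])
  note int = integrable_vec_nth[OF L2_integrable[OF lm has_weak_gradientD(2)[OF F]]]
    integrable_vec_nth[OF L2_integrable[OF lm has_weak_gradientD(2)[OF G]]]
  have "AE x in lebesgue_on \<Omega>. F x $ i - G x $ i = 0" for i
  proof (rule fundamental_lemma_calculus_of_variations[OF \<Omega>(1)])
    show "integrable (lebesgue_on \<Omega>) (\<lambda>x. F x $ i - G x $ i)"
      by (intro Bochner_Integration.integrable_diff int)
    fix \<eta> assume \<eta>: "\<eta> \<in> test_functions \<Omega>"
    have "(LINT x|lebesgue_on \<Omega>. (F x $ i - G x $ i) * \<eta> x) =
        (LINT x|lebesgue_on \<Omega>. F x $ i * \<eta> x) - (LINT x|lebesgue_on \<Omega>. G x $ i * \<eta> x)"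
      unfolding left_diff_distrib
      by (intro Bochner_Integration.integral_diff integrable_mult_test_function[OF _ \<eta>] int)
    then show "(LINT x|lebesgue_on \<Omega>. (F x $ i - G x $ i) * \<eta> x) = 0"
      using has_weak_gradientD(3)[OF F \<eta>, of i] has_weak_gradientD(3)[OF G \<eta>, of i] by simp
  qed
  then have "AE x in lebesgue_on \<Omega>. \<forall>i\<in>UNIV. F x $ i - G x $ i = 0"
    by (intro AE_finite_allI) auto
  then show ?thesis
    by eventually_elim (simp add: vec_eq_iff)
qed

lemma has_weak_gradient_grad: "f \<in> H1_space \<Omega> \<Longrightarrow> has_weak_gradient \<Omega> f (grad \<Omega> f)"
  unfolding H1_space_def grad_def mem_Collect_eq by (elim exE) (rule someI[of "has_weak_gradient \<Omega> f"])

subsection \<open>Piecewise affine functions\<close>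

lemma has_real_derivative_along_line:
  fixes f :: "'a::real_normed_vector \<Rightarrow> real"
  assumes f: "(f has_derivative f') (at (x + t *\<^sub>R v))"
  shows "((\<lambda>t. f (x + t *\<^sub>R v)) has_real_derivative f' v) (at t)"
proof -
  have "((\<lambda>t. x + t *\<^sub>R v) has_derivative (\<lambda>t. t *\<^sub>R v)) (at t)"
    by (auto intro!: derivative_eq_intros)
  from has_derivative_compose[OF this f]
  have "((\<lambda>t. f (x + t *\<^sub>R v)) has_derivative (\<lambda>s. f' (s *\<^sub>R v))) (at t)" .
  moreover have "(\<lambda>s. f' (s *\<^sub>R v)) = (*) (f' v)"
    using has_derivative_linear[OF f] by (simp add: linear_cmul fun_eq_iff)
  ultimately show ?thesis by (simp only: has_field_derivative_def)
qed

lemma difference_quotient_tendsto: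
  fixes f :: "'a::real_normed_vector \<Rightarrow> real"
  assumes f: "(f has_derivative f') (at x)" and h: "h \<longlonglongrightarrow> 0" "\<And>k. h k \<noteq> 0"
  shows "(\<lambda>k. (f (x + h k *\<^sub>R v) - f x) / h k) \<longlonglongrightarrow> f' v"
proof -
  have "((\<lambda>t. f (x + t *\<^sub>R v)) has_real_derivative f' v) (at 0)"
    by (rule has_real_derivative_along_line) (use f in simp)
  then have "(\<lambda>t. (f (x + t *\<^sub>R v) - f x) / t) \<midarrow>0\<rightarrow> f' v"
    by (simp add: DERIV_def)
  moreover have "filterlim h (at 0) sequentially"
    using h by (intro filterlim_atI) auto
  ultimately show ?thesis
    by (rule filterlim_compose)
qed

text \<open>The mean value inequality along a line, with a bound uniform in x because the
  directional derivative is itself a test function. It supplies a dominating constant for difference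
  quotients.\<close>

lemma test_function_difference_bound:
  assumes "\<eta> \<in> test_functions \<Omega>"
  obtains B where "B \<ge> 0" "\<And>x h. \<bar>\<eta> (x + h *\<^sub>R v) - \<eta> x\<bar> \<le> B * \<bar>h\<bar>"
proof -
  obtain B where B: "B \<ge> 0" "\<And>x. \<bar>frechet_derivative \<eta> (at x) v\<bar> \<le> B"
    using test_function_bounded[OF test_function_derivative[OF assms]] by metis
  have "\<bar>\<eta> (x + h *\<^sub>R v) - \<eta> x\<bar> \<le> B * \<bar>h\<bar>" for x h
  proof -
    have "((\<lambda>t. \<eta> (x + t *\<^sub>R v)) has_real_derivative frechet_derivative \<eta> (at (x + t *\<^sub>R v)) v) (at t)" for t
      by (rule has_real_derivative_along_line[OF test_function_has_derivative[OF assms]])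
    from field_differentiable_bound[of UNIV _ _ B h 0, OF _ has_field_derivative_at_within[OF this]] B
    show ?thesis by simp
  qed
  with B(1) show ?thesis by (rule that)
qed

text \<open>The cells cut the parameter interval into finitely many closed sets on each of which the
  restriction of f is Lipschitz, and such a cover keeps the constant. The union need not be convex,
  so the segment must be assumed to lie in it.\<close>

lemma lipschitz_along_segment:
  fixes f :: "'a::euclidean_space \<Rightarrow> real"
  assumes T: "finite \<T>" "\<And>K. K \<in> \<T> \<Longrightarrow> closed K" and L: "L \<ge> 0" "\<And>K. K \<in> \<T> \<Longrightarrow> L-lipschitz_on K f"
    and seg: "closed_segment x y \<subseteq> \<Union>\<T>"
  shows "\<bar>f y - f x\<bar> \<le> L * norm (y - x)"
proof -
  define \<gamma> where "\<gamma> = (\<lambda>t. x + t *\<^sub>R (y - x))"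
  have "(L * norm (y - x))-lipschitz_on {0..1} (f \<circ> \<gamma>)"
  proof (rule lipschitz_on_closed_Union[where I = \<T> and U = "\<lambda>K. \<gamma> -` K"])
    fix K assume K: "K \<in> \<T>"
    show "closed (\<gamma> -` K)"
      unfolding \<gamma>_def by (intro closed_vimage T K continuous_intros)
    show "(L * norm (y - x))-lipschitz_on (\<gamma> -` K) (f \<circ> \<gamma>)"
    proof (rule lipschitz_onI)
      fix s t assume "s \<in> \<gamma> -` K" "t \<in> \<gamma> -` K"
      then have "dist (f (\<gamma> s)) (f (\<gamma> t)) \<le> L * dist (\<gamma> s) (\<gamma> t)"
        using lipschitz_onD[OF L(2)[OF K]] by auto
      also have "dist (\<gamma> s) (\<gamma> t) = norm ((s - t) *\<^sub>R (y - x))"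
        by (simp add: \<gamma>_def dist_norm scaleR_diff_left)
      finally show "dist ((f \<circ> \<gamma>) s) ((f \<circ> \<gamma>) t) \<le> L * norm (y - x) * dist s t"
        by (simp add: dist_real_def mult_ac)
    qed (use L in simp)
  next
    have "\<gamma> t \<in> closed_segment x y" if "t \<in> {0..1}" for t
      using that by (auto simp: in_segment \<gamma>_def algebra_simps intro!: exI[of _ t])
    with seg show "{0..1} \<subseteq> (\<Union>K\<in>\<T>. \<gamma> -` K)" by blast
  qed (use T L in auto)
  from lipschitz_onD[OF this, of 1 0] show ?thesis
    by (simp add: \<gamma>_def dist_real_def)
qed

text \<open>Translation invariance is taken from \<open>lborel\<close> and carried to its
  completion, hence the Borel measurability of g.\<close>

lemma lebesgue_integral_translate:
  fixes g :: "'a::euclidean_space \<Rightarrow> real"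
  assumes g: "g \<in> borel_measurable borel" "integrable lebesgue g"
  shows "integrable lebesgue (\<lambda>x. g (c + x))" "(LINT x|lebesgue. g (c + x)) = (LINT x|lebesgue. g x)"
proof -
  have gc: "(\<lambda>x. g (c + x)) \<in> borel_measurable borel"
    using g(1) by measurable
  have "integrable lborel g" using g by (simp add: integrable_completion)
  then have "integrable (distr lborel borel ((+) c)) g" by (simp add: lborel_distr_plus)
  then have "integrable lborel (\<lambda>x. g (c + x))"
    by (rule integrable_distr[rotated]) simp
  then show "integrable lebesgue (\<lambda>x. g (c + x))"
    using gc by (simp add: integrable_completion)
  have "(LINT x|lborel. g (c + x)) = integral\<^sup>L (distr lborel borel ((+) c)) g"
    by (rule integral_distr[symmetric]) (use g in auto)
  then show "(LINT x|lebesgue. g (c + x)) = (LINT x|lebesgue. g x)"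
    using g(1) gc by (simp add: integral_completion lborel_distr_plus)
qed

text \<open>The weak gradient is the classical one on cell interiors. Moving a difference quotient
  from \<eta> to f is an exact translation identity; no jump terms arise in the limit because f is
  Lipschitz across cells along segments inside \<Omega>.\<close>

lemma piecewise_affine_in_H1:
  fixes \<Omega> :: "(real^'n) set"
  assumes \<Omega>: "open \<Omega>" "bounded \<Omega>" and T: "finite \<T>" "\<And>K. K \<in> \<T> \<Longrightarrow> closed K \<and> convex K" "\<Omega> \<subseteq> \<Union>\<T>"
    and f: "continuous_on (closure \<Omega>) f" and aff: "\<And>K. K \<in> \<T> \<Longrightarrow> \<exists>a c. \<forall>x\<in>K. f x = a \<bullet> x + c"
  shows "f \<in> H1_space \<Omega>"
proof -
  have lm: "\<Omega> \<in> lmeasurable" by (rule lmeasurable_open[OF \<Omega>(2,1)])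
  have \<Omega>l: "\<Omega> \<in> sets lebesgue" using \<Omega>(1) by (simp add: lborelD)
  have \<Omega>b: "\<Omega> \<in> sets borel" using \<Omega>(1) by simp
  have restrict: "(LINT x|lebesgue_on \<Omega>. g x) = (LINT x|lebesgue. indicator \<Omega> x * g x)" for g :: "_ \<Rightarrow> real"
    using integral_restrict_space[of \<Omega> lebesgue g] \<Omega>l by simp
  obtain a c where ac: "\<And>K x. K \<in> \<T> \<Longrightarrow> x \<in> K \<Longrightarrow> f x = a K \<bullet> x + c K"
    using aff by metis
  \<comment> \<open>The sum over the finitely many cells bounds every cell gradient by one
    constant.\<close>
  define L where "L = (\<Sum>K\<in>\<T>. norm (a K))"
  have L: "L \<ge> 0" by (simp add: L_def sum_nonneg)
  have aL: "norm (a K) \<le> L" if "K \<in> \<T>" for K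
    unfolding L_def by (rule member_le_sum) (use that T(1) in auto)
  have lip: "L-lipschitz_on K f" if K: "K \<in> \<T>" for K
  proof (rule lipschitz_onI)
    fix x y assume "x \<in> K" "y \<in> K"
    then have "dist (f x) (f y) = \<bar>a K \<bullet> (x - y)\<bar>"
      using ac[OF K] by (simp add: dist_real_def inner_diff_right)
    also have "\<dots> \<le> norm (a K) * norm (x - y)" by (rule Cauchy_Schwarz_ineq2)
    also have "\<dots> \<le> L * dist x y"
      unfolding dist_norm by (intro mult_right_mono aL K) simp
    finally show "dist (f x) (f y) \<le> L * dist x y" .
  qed (rule L)
  have "compact (f ` closure \<Omega>)"
    by (rule compact_continuous_image[OF f]) (use \<Omega>(2) in simp)
  then obtain Cf where Cf: "Cf > 0" "\<And>x. x \<in> closure \<Omega> \<Longrightarrow> \<bar>f x\<bar> \<le> Cf"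
    using compact_imp_bounded bounded_pos by (metis imageI real_norm_def)
  \<comment> \<open>Extension by zero makes translates meaningful everywhere. A jump at the boundary
    of \<Omega> is harmless, since \<eta> vanishes near it.\<close>
  define F where "F = (\<lambda>x. indicator \<Omega> x * f x)"
  have F_bound: "\<bar>F x\<bar> \<le> Cf * indicator \<Omega> x" for x
    using Cf closure_subset[of \<Omega>] by (auto simp: F_def indicator_def)
  have F_meas[measurable]: "F \<in> borel_measurable borel"
    using borel_measurable_continuous_on_indicator[OF \<Omega>b continuous_on_subset[OF f closure_subset]]
    by (simp add: F_def)

  define U where "U = (\<Union>K\<in>\<T>. interior K)"
  \<comment> \<open>Using the derivative of f instead of a chosen cell gives a well-defined value;
    the default 0 matters inside \<Omega> only on a null set.\<close>
  define G :: "real^'n \<Rightarrow> real^'n"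
    where "G = (\<lambda>x. if x \<in> U then (\<chi> i. frechet_derivative f (at x) (axis i 1)) else 0)"
  have deriv: "(f has_derivative (\<lambda>v. a K \<bullet> v)) (at x)" if "K \<in> \<T>" "x \<in> interior K" for K x
  proof (rule has_derivative_transform_within_open)
    show "((\<lambda>x. a K \<bullet> x + c K) has_derivative (\<lambda>v. a K \<bullet> v)) (at x)"
      by (auto intro!: derivative_eq_intros)
    show "a K \<bullet> y + c K = f y" if "y \<in> interior K" for y
      using ac[OF \<open>K \<in> \<T>\<close> subsetD[OF interior_subset that]] by simp
  qed (use that in auto)
  have G_eq: "G x = a K" if K: "K \<in> \<T>" "x \<in> interior K" for K x
  proof -
    have "frechet_derivative f (at x) = (\<lambda>v. a K \<bullet> v)"
      using frechet_derivative_at[OF deriv[OF K]] by simp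
    moreover have "x \<in> U" using K by (auto simp: U_def)
    ultimately show ?thesis by (simp add: G_def vec_eq_iff inner_axis)
  qed
  have G_bound: "norm (G x) \<le> L" for x
  proof (cases "x \<in> U")
    case True
    then obtain K where "K \<in> \<T>" "x \<in> interior K" by (auto simp: U_def)
    then show ?thesis using G_eq aL by simp
  qed (use L in \<open>simp add: G_def\<close>)
  \<comment> \<open>G is constant on finitely many Borel pieces.\<close>
  have G_meas: "G \<in> borel_measurable borel"
  proof (rule measurable_piecewise_restrict[of "insert (- U) (interior ` \<T>)"])
    fix V assume "V \<in> insert (- U) (interior ` \<T>)"
    then consider "V = - U" | K where "K \<in> \<T>" "V = interior K" by blast
    then obtain g where "\<And>x. x \<in> V \<Longrightarrow> G x = g"
    proof cases
      case 1
      then show ?thesis using that[of 0] by (simp add: G_def)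
    next
      case 2
      then show ?thesis using that[of "a K"] G_eq by simp
    qed
    then show "G \<in> borel_measurable (restrict_space borel V)"
      by (subst measurable_cong[where g = "\<lambda>_. g"]) (auto simp: space_restrict_space)
  next
    show "countable (insert (- U) (interior ` \<T>))"
      using T(1) by (simp add: countable_finite)
    show "space borel \<subseteq> \<Union> (insert (- U) (interior ` \<T>))"
      by (auto simp: U_def)
    have "open U" by (auto simp: U_def)
    then show "V \<inter> space borel \<in> sets borel" if "V \<in> insert (- U) (interior ` \<T>)" for V
      using that by auto
  qed
  have f_L2: "f \<in> L2_space \<Omega>"
  proof (rule bounded_imp_L2[OF lm])
    show "f \<in> borel_measurable (lebesgue_on \<Omega>)"
      by (rule continuous_imp_measurable_on_sets_lebesgue[OF continuous_on_subset[OF f closure_subset] \<Omega>l])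
    show "norm (f x) \<le> Cf" if "x \<in> \<Omega>" for x
      using Cf(2) that closure_subset by auto
  qed
  have G_L2: "G \<in> L2_space \<Omega>"
  proof (rule bounded_imp_L2[OF lm _ G_bound])
    show "G \<in> borel_measurable (lebesgue_on \<Omega>)"
      using G_meas by (intro measurable_restrict_space1 measurable_completion) auto
  qed
  \<comment> \<open>Frontiers of convex sets are negligible, and a point of \<Omega> off all of them
    is interior to some cell.\<close>
  have AE_U: "AE x in lebesgue. x \<in> \<Omega> \<longrightarrow> x \<in> U"
  proof -
    have "negligible (\<Union>(frontier ` \<T>))"
      using T(1,2) by (intro negligible_Union) (auto intro: negligible_convex_frontier)
    then have "AE x in lebesgue. x \<notin> (\<Union>K\<in>\<T>. frontier K)"
      by (intro AE_not_in) (simp add: negligible_iff_null_sets)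
    then show ?thesis
    proof eventually_elim
      case (elim x)
      show ?case
      proof
        assume "x \<in> \<Omega>"
        then obtain K where "K \<in> \<T>" "x \<in> K" using T(3) by blast
        with elim T(2) have "x \<in> interior K" by (auto simp: frontier_def)
        with \<open>K \<in> \<T>\<close> show "x \<in> U" by (auto simp: U_def)
      qed
    qed
  qed
  have bounded_integrable: "integrable lebesgue g"
    if "g \<in> borel_measurable borel" "\<And>x. \<bar>g x\<bar> \<le> B * indicator \<Omega> x" for g :: "_ \<Rightarrow> real" and B
  proof (rule Bochner_Integration.integrable_bound)
    have "integrable lebesgue (indicat_real \<Omega>)"
      using fmeasurableD2[OF lm]
      by (intro integrable_real_indicator fmeasurableD[OF lm]) (simp only: infinity_ennreal_def less_top)
    then show "integrable lebesgue (\<lambda>x. B * indicator \<Omega> x)" by simp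
    show "g \<in> borel_measurable lebesgue"
      using that(1) by (intro measurable_completion) auto
    show "AE x in lebesgue. norm (g x) \<le> norm (B * indicator \<Omega> x)"
      using that(2) by (intro AE_I2) (simp add: order_trans[OF _ abs_ge_self])
  qed

  have "has_weak_gradient \<Omega> f G"
    unfolding has_weak_gradient_def
  proof (intro conjI f_L2 G_L2 ballI allI)
    fix \<eta> :: "real^'n \<Rightarrow> real" and i :: 'n
    assume \<eta>: "\<eta> \<in> test_functions \<Omega>"
    define e :: "real^'n" where "e = axis i 1"
    define S where "S = closure {x. \<eta> x \<noteq> 0}"
    have S: "compact S" "S \<subseteq> \<Omega>" using \<eta> by (auto simp: S_def test_functions_def)
    have \<eta>0: "\<eta> x = 0" if "x \<notin> S" for x
      using that closure_subset[of "{x. \<eta> x \<noteq> 0}"] by (auto simp: S_def)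
    have \<eta>_meas[measurable]: "\<eta> \<in> borel_measurable borel"
      by (rule borel_measurable_continuous_onI[OF test_function_continuous[OF \<eta>]])
    have d\<eta>_meas[measurable]: "(\<lambda>x. frechet_derivative \<eta> (at x) e) \<in> borel_measurable borel"
      by (rule borel_measurable_continuous_onI[OF test_function_continuous[OF test_function_derivative[OF \<eta>]]])
    obtain B0 where B0: "B0 \<ge> 0" "\<And>x. \<bar>\<eta> x\<bar> \<le> B0" using test_function_bounded[OF \<eta>] by blast
    obtain B1 where B1: "B1 \<ge> 0" "\<And>x h. \<bar>\<eta> (x + h *\<^sub>R e) - \<eta> x\<bar> \<le> B1 * \<bar>h\<bar>"
      using test_function_difference_bound[OF \<eta>] by blast
    obtain \<delta> where \<delta>: "\<delta> > 0" "(\<Union>x\<in>S. ball x \<delta>) \<subseteq> \<Omega>"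
      using compact_subset_open_imp_ball_epsilon_subset[OF S(1) \<Omega>(1) S(2)] by blast
    \<comment> \<open>The shift k + 2 keeps h strictly below \<delta> already at k = 0.\<close>
    define h where "h = (\<lambda>k. \<delta> / real (k + 2))"
    have h: "0 < h k" "h k < \<delta>" for k
      using \<delta>(1) by (auto simp: h_def field_simps intro: add_pos_nonneg)
    have h_lim: "h \<longlonglongrightarrow> 0"
      unfolding h_def by (rule LIMSEQ_ignore_initial_segment[OF lim_const_over_n])
    \<comment> \<open>\<open>A\<close> differences \<eta> forwards, \<open>B\<close> differences F
      backwards. With the step -e and division by +h, \<open>B\<close> tends to minus the
      derivative, so the sign of integration by parts is built in.\<close>
    define A where "A = (\<lambda>k x. F x * ((\<eta> (x + h k *\<^sub>R e) - \<eta> x) / h k))"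
    define B where "B = (\<lambda>k x. (F (x + h k *\<^sub>R (- e)) - F x) / h k * \<eta> x)"
    have A_meas: "A k \<in> borel_measurable borel" for k unfolding A_def by measurable
    have B_meas: "B k \<in> borel_measurable borel" for k unfolding B_def by measurable
    have A_bound: "\<bar>A k x\<bar> \<le> (Cf * B1) * indicator \<Omega> x" for k x
    proof -
      have "\<bar>(\<eta> (x + h k *\<^sub>R e) - \<eta> x) / h k\<bar> \<le> B1"
        using B1(2)[of x "h k"] h(1)[of k] by (simp add: abs_divide field_simps)
      from mult_mono[OF F_bound[of x] this] Cf(1) show ?thesis
        by (simp add: A_def abs_mult mult_ac)
    qed
    \<comment> \<open>On the support of \<eta> the segment to the shifted point stays within a ball
      inside \<Omega>, where f has Lipschitz constant L; elsewhere \<eta> is zero.\<close>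
    have B_bound: "\<bar>B k x\<bar> \<le> (L * B0) * indicator \<Omega> x" for k x
    proof (cases "x \<in> S")
      case True
      let ?y = "x + h k *\<^sub>R (- e)"
      have ball: "ball x \<delta> \<subseteq> \<Omega>" using \<delta>(2) True by blast
      have norm_y: "norm (?y - x) = h k" using h(1)[of k] by (simp add: e_def)
      then have y: "?y \<in> ball x \<delta>" using h(2)[of k] by (simp add: dist_norm norm_minus_commute)
      then have "closed_segment x ?y \<subseteq> ball x \<delta>"
        using \<delta>(1) by (intro closed_segment_subset convex_ball) auto
      then have "closed_segment x ?y \<subseteq> \<Union>\<T>" using ball T(3) by blast
      then have "\<bar>f ?y - f x\<bar> \<le> L * h k"
        using lipschitz_along_segment[OF T(1) _ L lip] T(2) norm_y by metis
      moreover have "x \<in> \<Omega>" "?y \<in> \<Omega>" using True S(2) y ball by auto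
      ultimately have "\<bar>(F ?y - F x) / h k\<bar> \<le> L"
        using h(1)[of k] by (simp add: F_def abs_divide field_simps)
      from mult_mono[OF this B0(2)[of x]] L \<open>x \<in> \<Omega>\<close> show ?thesis
        by (simp add: B_def abs_mult)
    qed (use L B0 in \<open>simp add: B_def \<eta>0\<close>)
    note A_int = bounded_integrable[OF A_meas A_bound]
    note B_int = bounded_integrable[OF B_meas B_bound]
    have AB: "(LINT x|lebesgue. A k x) = (LINT x|lebesgue. B k x)" for k
    proof -
      \<comment> \<open>The products F(x) \<eta>(x) cancel in A - B. What remains is the difference
        of P and its translate by h e, divided by h, whose integral is zero.\<close>
      define P where "P = (\<lambda>x. F x * \<eta> (x + h k *\<^sub>R e))"
      have P_meas: "P \<in> borel_measurable borel" unfolding P_def by measurable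
      have "\<bar>P x\<bar> \<le> (Cf * B0) * indicator \<Omega> x" for x
        using mult_mono[OF F_bound[of x] B0(2)[of "x + h k *\<^sub>R e"]] Cf(1)
        by (simp add: P_def abs_mult mult_ac)
      note P_int = bounded_integrable[OF P_meas this]
      note tr = lebesgue_integral_translate[OF P_meas P_int, of "- (h k *\<^sub>R e)"]
      have "(LINT x|lebesgue. A k x) - (LINT x|lebesgue. B k x) = (LINT x|lebesgue. A k x - B k x)"
        by (rule Bochner_Integration.integral_diff[OF A_int B_int, symmetric])
      also have "\<dots> = (LINT x|lebesgue. (P x - P (- (h k *\<^sub>R e) + x)) / h k)"
        using h(1)[of k]
        by (intro Bochner_Integration.integral_cong refl) (simp add: A_def B_def P_def field_simps)
      also have "\<dots> = ((LINT x|lebesgue. P x) - (LINT x|lebesgue. P (- (h k *\<^sub>R e) + x))) / h k"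
        by (simp only: integral_divide_zero Bochner_Integration.integral_diff[OF P_int tr(1)])
      also have "\<dots> = 0" by (simp only: tr(2) diff_self div_0)
      finally show ?thesis by simp
    qed
    have w: "integrable lebesgue (\<lambda>x. C * indicat_real \<Omega> x)" for C
      using \<Omega>b by (intro bounded_integrable[where B = "\<bar>C\<bar>"]) (auto simp: abs_mult)
    have "(\<lambda>k. LINT x|lebesgue. A k x) \<longlonglongrightarrow> (LINT x|lebesgue. F x * frechet_derivative \<eta> (at x) e)"
    proof (rule integral_dominated_convergence[OF _ _ w])
      show "(\<lambda>x. F x * frechet_derivative \<eta> (at x) e) \<in> borel_measurable lebesgue"
        by (intro measurable_completion) measurable
      show "A k \<in> borel_measurable lebesgue" for k using A_int by blast
      show "AE x in lebesgue. norm (A k x) \<le> (Cf * B1) * indicator \<Omega> x" for k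
        using A_bound by simp
      show "AE x in lebesgue. (\<lambda>k. A k x) \<longlonglongrightarrow> F x * frechet_derivative \<eta> (at x) e"
        unfolding A_def
        by (intro AE_I2 tendsto_mult tendsto_const difference_quotient_tendsto h_lim
            test_function_has_derivative[OF \<eta>]) (use h(1) in \<open>simp add: less_imp_neq[symmetric]\<close>)
    qed
    moreover have "(\<lambda>k. LINT x|lebesgue. B k x) \<longlonglongrightarrow> (LINT x|lebesgue. - (G x $ i * \<eta> x))"
    proof (rule integral_dominated_convergence[OF _ _ w])
      have "(\<lambda>x. G x $ i) \<in> borel_measurable borel"
        by (rule borel_measurable_continuous_on[OF continuous_on_component[OF continuous_on_id] G_meas])
      then have "(\<lambda>x. - (G x $ i * \<eta> x)) \<in> borel_measurable borel" by measurable
      then show "(\<lambda>x. - (G x $ i * \<eta> x)) \<in> borel_measurable lebesgue"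
        by (intro measurable_completion) simp
      show "B k \<in> borel_measurable lebesgue" for k using B_int by blast
      show "AE x in lebesgue. norm (B k x) \<le> (L * B0) * indicator \<Omega> x" for k
        using B_bound by simp
      show "AE x in lebesgue. (\<lambda>k. B k x) \<longlonglongrightarrow> - (G x $ i * \<eta> x)"
        using AE_U
      proof eventually_elim
        case (elim x)
        show ?case
        proof (cases "x \<in> S")
          case True
          with S(2) elim have x: "x \<in> \<Omega>" "x \<in> U" by auto
          then obtain K where K: "K \<in> \<T>" "x \<in> interior K" by (auto simp: U_def)
          \<comment> \<open>F agrees with f on the open set \<Omega>, so it inherits the cell
            gradient at x.\<close>
          have "(F has_derivative (\<lambda>v. a K \<bullet> v)) (at x)"
            by (rule has_derivative_transform_within_open[OF deriv[OF K] \<Omega>(1) x(1)]) (simp add: F_def)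
          from difference_quotient_tendsto[OF this h_lim, of "- e"] h(1)
          have "(\<lambda>k. (F (x + h k *\<^sub>R (- e)) - F x) / h k) \<longlonglongrightarrow> a K \<bullet> (- e)"
            by (simp add: less_imp_neq[symmetric])
          also have "a K \<bullet> (- e) = - (G x $ i)"
            by (simp add: G_eq[OF K] e_def inner_axis)
          finally show ?thesis
            unfolding B_def minus_mult_left by (rule tendsto_mult_right)
        qed (simp add: B_def \<eta>0)
      qed
    qed
    ultimately have eq: "(LINT x|lebesgue. F x * frechet_derivative \<eta> (at x) e) = (LINT x|lebesgue. - (G x $ i * \<eta> x))"
      unfolding AB by (rule LIMSEQ_unique)
    \<comment> \<open>The support of \<eta> lies in \<Omega>, so restricting the integral to
      \<Omega> changes nothing.\<close>
    have "(\<lambda>x. indicator \<Omega> x * (G x $ i * \<eta> x)) = (\<lambda>x. G x $ i * \<eta> x)"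
      using S(2) \<eta>0 by (auto simp: indicator_def fun_eq_iff)
    with eq show "(LINT x|lebesgue_on \<Omega>. f x * frechet_derivative \<eta> (at x) (axis i 1)) =
        - (LINT x|lebesgue_on \<Omega>. G x $ i * \<eta> x)"
      unfolding restrict by (simp add: F_def e_def mult.assoc)
  qed
  then show ?thesis by (auto simp: H1_space_def)
qed

subsection \<open>The energy estimate\<close>

lemma l2_inner_commute: "l2_inner \<Omega> f g = l2_inner \<Omega> g f"
  by (simp add: l2_inner_def inner_commute)

lemma l2_norm_power2: "(l2_norm \<Omega> f)\<^sup>2 = l2_inner \<Omega> f f"
  by (simp add: l2_norm_def l2_inner_def Bochner_Integration.integral_nonneg)

lemma l2_inner_diff_quotient:
  assumes "f \<in> L2_space \<Omega>" "g \<in> L2_space \<Omega>" "k \<in> L2_space \<Omega>"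
  shows "l2_inner \<Omega> f (\<lambda>x. (g x - k x) /\<^sub>R d) = (l2_inner \<Omega> f g - l2_inner \<Omega> f k) / d"
  unfolding l2_inner_def
  by (simp add: inner_diff_right Bochner_Integration.integral_diff L2_inner_integrable assms divide_inverse_commute)

text \<open>The polarization identity \<open>2a(a - b) = a\<^sup>2 - b\<^sup>2 + (a - b)\<^sup>2\<close> with its nonnegative square dropped.\<close>

lemma l2_inner_polarization_bound:
  assumes f: "f \<in> L2_space \<Omega>" and g: "g \<in> L2_space \<Omega>"
  shows "(l2_inner \<Omega> f f - l2_inner \<Omega> g g) / 2 \<le> l2_inner \<Omega> f f - l2_inner \<Omega> f g"
proof -
  have "0 \<le> (LINT x|lebesgue_on \<Omega>. (f x - g x) \<bullet> (f x - g x))"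
    by (intro Bochner_Integration.integral_nonneg) simp
  also have "\<dots> = (LINT x|lebesgue_on \<Omega>. (f x \<bullet> f x - 2 * (f x \<bullet> g x)) + g x \<bullet> g x)"
    by (simp add: inner_diff_left inner_diff_right inner_commute algebra_simps)
  also have "\<dots> = l2_inner \<Omega> f f - 2 * l2_inner \<Omega> f g + l2_inner \<Omega> g g"
    by (simp add: l2_inner_def L2_inner_integrable f g)
  finally show ?thesis by simp
qed

lemma modified_energy_eq:
  assumes "u n \<in> L2_space \<Omega>" "grad \<Omega> (\<phi> n) \<in> L2_space \<Omega>"
  shows "modified_energy \<Omega> \<phi> u r n =
    (l2_inner \<Omega> (u n) (u n) + l2_inner \<Omega> (grad \<Omega> (\<phi> n)) (grad \<Omega> (\<phi> n))) / 2 + (r n)\<^sup>2"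
  using assms by (simp add: modified_energy_def l2_inner_def power2_norm_eq_inner L2_inner_integrable)

text \<open>Bridges the componentwise condition in \<open>X_space\<close> and the square
  integrability of the whole vector field.\<close>

lemma L2_vector:
  fixes v :: "real^'n \<Rightarrow> real^'m"
  assumes "\<And>i. (\<lambda>x. v x $ i) \<in> L2_space \<Omega>"
  shows "v \<in> L2_space \<Omega>"
proof -
  have comp: "(\<lambda>x. v x $ i) \<in> borel_measurable (lebesgue_on \<Omega>)"
    "integrable (lebesgue_on \<Omega>) (\<lambda>x. (v x $ i)\<^sup>2)" for i
    using assms[of i] by (simp_all add: L2_space_def)
  have "(\<lambda>x. v x \<bullet> b) \<in> borel_measurable (lebesgue_on \<Omega>)" if "b \<in> Basis" for b
    using that comp(1) by (auto simp: Basis_vec_def inner_axis)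
  then have "v \<in> borel_measurable (lebesgue_on \<Omega>)"
    by (subst borel_measurable_euclidean_space) blast
  moreover have "(norm (v x))\<^sup>2 = (\<Sum>i\<in>UNIV. (v x $ i)\<^sup>2)" for x
    by (simp only: power2_norm_eq_inner inner_vec_def) (simp add: power2_eq_square)
  ultimately show ?thesis
    using comp(2) by (simp add: L2_space_def)
qed

lemma X_space_L2: "v \<in> X_space \<Omega> \<T> b \<Longrightarrow> v \<in> L2_space \<Omega>"
  by (intro L2_vector has_weak_gradientD(1)[OF has_weak_gradient_grad])
    (simp add: X_space_def H10_space_def)

text \<open>Makes the discrete time derivative of \<phi> an admissible test function in the equation
  for \<mu>.\<close>

lemma W_space_dquot:
  assumes "f m \<in> W_space \<Omega> \<T>" "f (m - 1) \<in> W_space \<Omega> \<T>"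
  shows "dquot d f m \<in> W_space \<Omega> \<T>"
  unfolding W_space_def
proof (intro CollectI conjI ballI)
  show "continuous_on (closure \<Omega>) (dquot d f m)"
    using assms unfolding dquot_def[abs_def] W_space_def by (auto intro!: continuous_intros)
  fix K assume "K \<in> \<T>"
  then obtain a c a' c' where "\<forall>x\<in>K. f m x = a \<bullet> x + c" "\<forall>x\<in>K. f (m - 1) x = a' \<bullet> x + c'"
    using assms unfolding W_space_def by fast
  then have "\<forall>x\<in>K. dquot d f m x = ((a - a') /\<^sub>R d) \<bullet> x + (c - c') / d"
    by (simp add: dquot_def inner_diff_left divide_inverse algebra_simps)
  then show "\<exists>a c. \<forall>x\<in>K. dquot d f m x = a \<bullet> x + c" by blast
qed

text \<open>The chosen gradient of the quotient and the quotient of the chosen gradients are both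
  weak gradients of one function. They agree almost everywhere, and the integral does not see the
  exceptional set.\<close>

lemma l2_inner_grad_dquot:
  assumes \<Omega>: "open \<Omega>" "bounded \<Omega>" and H1: "f m \<in> H1_space \<Omega>" "f (m - 1) \<in> H1_space \<Omega>"
    and G: "G \<in> L2_space \<Omega>"
  shows "l2_inner \<Omega> G (grad \<Omega> (dquot d f m)) =
    (l2_inner \<Omega> G (grad \<Omega> (f m)) - l2_inner \<Omega> G (grad \<Omega> (f (m - 1)))) / d"
proof -
  let ?D = "\<lambda>x. (grad \<Omega> (f m) x - grad \<Omega> (f (m - 1)) x) /\<^sub>R d"
  have dq: "dquot d f m = (\<lambda>x. inverse d *\<^sub>R f m x + (- inverse d) *\<^sub>R f (m - 1) x)"
    by (simp add: dquot_def fun_eq_iff algebra_simps)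
  have D: "?D = (\<lambda>x. inverse d *\<^sub>R grad \<Omega> (f m) x + (- inverse d) *\<^sub>R grad \<Omega> (f (m - 1)) x)"
    by (simp add: fun_eq_iff algebra_simps)
  note L2 = H1[THEN has_weak_gradient_grad, THEN has_weak_gradientD(2)]
  have wg: "has_weak_gradient \<Omega> (dquot d f m) ?D"
    unfolding dq D
    by (intro has_weak_gradient_lincomb lmeasurable_open[OF \<Omega>(2,1)] has_weak_gradient_grad H1)
  then have dq_H1: "dquot d f m \<in> H1_space \<Omega>" unfolding H1_space_def by blast
  have "?D \<in> L2_space \<Omega>" unfolding D by (intro L2_lincomb L2)
  moreover have "AE x in lebesgue_on \<Omega>. grad \<Omega> (dquot d f m) x = ?D x"
    by (rule weak_gradient_unique[OF \<Omega> has_weak_gradient_grad[OF dq_H1] wg])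
  moreover have "grad \<Omega> (dquot d f m) \<in> L2_space \<Omega>"
    using has_weak_gradientD(2)[OF has_weak_gradient_grad[OF dq_H1]] .
  ultimately have "l2_inner \<Omega> G (grad \<Omega> (dquot d f m)) = l2_inner \<Omega> G ?D"
    unfolding l2_inner_def
    by (intro integral_cong_AE borel_measurable_integrable L2_inner_integrable G) (auto elim: eventually_mono)
  with l2_inner_diff_quotient[OF G L2, of d] show ?thesis by simp
qed

text \<open>Simplices are polytopes, hence closed and convex, and finitely many of them cover
  \<Omega>.\<close>

lemma W_space_H1:
  assumes "polygonal_domain \<Omega>" "simplicial_mesh \<Omega> \<T>" "f \<in> W_space \<Omega> \<T>"
  shows "f \<in> H1_space \<Omega>"
proof (rule piecewise_affine_in_H1)
  show "open \<Omega>" "bounded \<Omega>" using assms(1) by (auto simp: polygonal_domain_def)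
  show "finite \<T>" "\<Omega> \<subseteq> \<Union>\<T>"
    using assms(2) closure_subset by (auto simp: simplicial_mesh_def triangulation_def)
  show "continuous_on (closure \<Omega>) f" using assms(3) by (simp add: W_space_def)
  fix K assume K: "K \<in> \<T>"
  then have "polytope K" using assms(2) simplex_imp_polytope by (auto simp: simplicial_mesh_def)
  then show "closed K \<and> convex K" by (simp add: polytope_imp_closed polytope_imp_convex)
  show "\<exists>a c. \<forall>x\<in>K. f x = a \<bullet> x + c" using assms(3) K by (simp add: W_space_def)
qed

theorem theorem2p1:
  fixes \<Omega> :: "(real^'n) set" and \<T> :: "(real^'n) set set"
    and b :: "(real^'n) set \<Rightarrow> real^'n \<Rightarrow> real"
    and \<epsilon> C\<^sub>0 \<sigma> T \<Delta>t :: real and N n :: nat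
    and \<phi>\<^sub>0 \<mu>\<^sub>0 :: "real^'n \<Rightarrow> real" and u\<^sub>0 :: "real^'n \<Rightarrow> real^'n"
    and \<phi> \<mu> p :: "nat \<Rightarrow> real^'n \<Rightarrow> real" and u :: "nat \<Rightarrow> real^'n \<Rightarrow> real^'n"
    and r :: "nat \<Rightarrow> real"
  assumes dim: "CARD('n) = 2 \<or> CARD('n) = 3"
    and domain: "polygonal_domain \<Omega>"
    and mesh: "simplicial_mesh \<Omega> \<T>" "shape_regular \<sigma> \<T>"
    and bubble: "\<And>K. K \<in> \<T> \<Longrightarrow> bubble_function K (b K)"
    and params: "\<epsilon> > 0" "C\<^sub>0 > 0"
    and time: "T > 0" "N > 0" "\<Delta>t = T / real N" "n < N"
    and data: "\<phi>\<^sub>0 \<in> H1_space \<Omega>" "\<mu>\<^sub>0 \<in> H1_space \<Omega>" "u\<^sub>0 \<in> L2_space \<Omega>"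
    and init: "sav_initial \<Omega> \<T> b \<epsilon> C\<^sub>0 \<phi>\<^sub>0 \<mu>\<^sub>0 u\<^sub>0 \<phi> \<mu> u r"
    and scheme: "\<And>k. k \<le> n \<Longrightarrow> sav_step \<Omega> \<T> b \<epsilon> C\<^sub>0 \<Delta>t \<phi> \<mu> u p r k"
  shows "modified_energy \<Omega> \<phi> u r (n + 1) - modified_energy \<Omega> \<phi> u r n
         \<le> - \<Delta>t * ((l2_norm \<Omega> (grad \<Omega> (\<mu> (n + 1))))\<^sup>2 + (l2_norm \<Omega> (vgrad \<Omega> (u (n + 1))))\<^sup>2)"
proof -
  have \<Omega>: "open \<Omega>" "bounded \<Omega>" using domain by (auto simp: polygonal_domain_def)
  have dt: "\<Delta>t > 0" using time by simp
  note step = scheme[OF order_refl, unfolded sav_step_def]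
  have new: "\<phi> (n + 1) \<in> W_space \<Omega> \<T>" "\<mu> (n + 1) \<in> W_space \<Omega> \<T>" "u (n + 1) \<in> X_space \<Omega> \<T> b"
    "p (n + 1) \<in> M_space \<Omega> \<T>" "r (n + 1) \<noteq> 0"
    using step by blast+
  \<comment> \<open>The old iterates lie in the discrete spaces by the initialization if n = 0 and
    by the preceding step otherwise.\<close>
  have old: "\<phi> n \<in> W_space \<Omega> \<T> \<and> u n \<in> X_space \<Omega> \<T> b"
  proof (cases n)
    case 0
    then show ?thesis
      using init by (simp add: sav_initial_def is_ritz_projection_def is_L2_projection_def)
  next
    case (Suc m)
    then show ?thesis using scheme[of m] by (simp add: sav_step_def)
  qed
  let ?s = "sav_coeff \<Omega> \<epsilon> C\<^sub>0 \<phi> r n"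
  let ?\<mu> = "\<mu> (n + 1)" and ?d\<phi> = "dquot \<Delta>t \<phi> (n + 1)" and ?u = "u (n + 1)" and ?p = "p (n + 1)"
  let ?g = "l2_inner \<Omega> (\<lambda>x. dpotential \<epsilon> (\<phi> n x)) ?d\<phi>"
  let ?c1 = "l2_inner \<Omega> (convect \<Omega> (u n) (\<phi> n)) ?\<mu>"
  let ?c2 = "l2_inner \<Omega> (vconvect \<Omega> (u n) (u n)) ?u"
  let ?c3 = "l2_inner \<Omega> (\<lambda>x. \<mu> n x *\<^sub>R grad \<Omega> (\<phi> n) x) ?u"
  let ?A = "l2_inner \<Omega> (grad \<Omega> ?\<mu>) (grad \<Omega> ?\<mu>)" and ?B = "l2_inner \<Omega> (vgrad \<Omega> ?u) (vgrad \<Omega> ?u)"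
  let ?I = "l2_inner \<Omega> ?\<mu> ?d\<phi>"
  let ?P = "l2_inner \<Omega> (grad \<Omega> (\<phi> (n + 1))) (grad \<Omega> ?d\<phi>)"
  let ?V = "l2_inner \<Omega> (dquot \<Delta>t u (n + 1)) ?u"
  have d\<phi>: "?d\<phi> \<in> W_space \<Omega> \<T>"
    using W_space_dquot[of \<phi> "n + 1"] new old by simp
  have eq_\<phi>: "?I + ?A + ?s * ?c1 = 0"
    using step new(2) l2_inner_commute[of \<Omega> ?d\<phi> ?\<mu>] by metis
  have eq_\<mu>: "?I - ?P - ?g = 0"
    using step d\<phi> by blast
  have eq_u: "?V + ?s * ?c2 - l2_inner \<Omega> ?p (divergence \<Omega> ?u) + ?B - ?s * ?c3 = 0"
    using step new(3) by blast
  \<comment> \<open>Discrete incompressibility tested with the new pressure removes the pressure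
    term from \<open>eq_u\<close>.\<close>
  have eq_p: "l2_inner \<Omega> ?p (divergence \<Omega> ?u) = 0"
    using step new(4) l2_inner_commute[of \<Omega> "divergence \<Omega> ?u" ?p] by metis
  have "(r (n + 1) - r n) / \<Delta>t = 1 / (2 * r (n + 1)) * (?g + ?s * (?c2 + ?c1 - ?c3))"
    using step by blast
  then have eq_r: "2 * r (n + 1) * (r (n + 1) - r n) / \<Delta>t = ?g + ?s * (?c2 + ?c1 - ?c3)"
    using new(5) by (simp add: field_simps)
  \<comment> \<open>\<open>eq_\<phi>\<close> minus \<open>eq_\<mu>\<close> eliminates
    \<open>?I\<close>; adding \<open>eq_u\<close> leaves \<open>?g\<close> and the three coupling
    terms in exactly the combination on the right of \<open>eq_r\<close>.\<close>
  have "?A + ?B + ?P + ?V + 2 * r (n + 1) * (r (n + 1) - r n) / \<Delta>t = 0"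
    using eq_\<phi> eq_\<mu> eq_u eq_p eq_r by (simp add: algebra_simps)
  then have balance: "\<Delta>t * ?P + \<Delta>t * ?V + 2 * r (n + 1) * (r (n + 1) - r n) = - \<Delta>t * (?A + ?B)"
    using dt by (simp add: field_simps)

  have H1: "\<phi> (n + 1) \<in> H1_space \<Omega>" "\<phi> n \<in> H1_space \<Omega>"
    using new(1) old W_space_H1[OF domain mesh(1)] by auto
  note L2_\<phi> = H1[THEN has_weak_gradient_grad, THEN has_weak_gradientD(2)]
  have L2_u: "?u \<in> L2_space \<Omega>" "u n \<in> L2_space \<Omega>" using X_space_L2 new(3) old by auto
  have P: "\<Delta>t * ?P = l2_inner \<Omega> (grad \<Omega> (\<phi> (n + 1))) (grad \<Omega> (\<phi> (n + 1)))
      - l2_inner \<Omega> (grad \<Omega> (\<phi> (n + 1))) (grad \<Omega> (\<phi> n))"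
    using l2_inner_grad_dquot[OF \<Omega>, of \<phi> "n + 1" "grad \<Omega> (\<phi> (n + 1))" \<Delta>t] H1 L2_\<phi> dt by simp
  have "?V = l2_inner \<Omega> ?u (\<lambda>x. (?u x - u n x) /\<^sub>R \<Delta>t)"
    by (subst l2_inner_commute) (simp add: dquot_def[abs_def])
  then have V: "\<Delta>t * ?V = l2_inner \<Omega> ?u ?u - l2_inner \<Omega> ?u (u n)"
    using l2_inner_diff_quotient[OF L2_u(1) L2_u, of \<Delta>t] dt by simp
  \<comment> \<open>The scalar polarization bound. The energy carries r^2 without a factor 1/2,
    which matches the 2 here, whereas the two L2 bounds supply the halves of the other
    terms.\<close>
  have "(r (n + 1))\<^sup>2 - (r n)\<^sup>2 \<le> 2 * r (n + 1) * (r (n + 1) - r n)"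
    using zero_le_power2[of "r (n + 1) - r n"] by (simp add: power2_eq_square algebra_simps)
  with balance P V l2_inner_polarization_bound[OF L2_\<phi>] l2_inner_polarization_bound[OF L2_u]
  show ?thesis
    unfolding modified_energy_eq[of u "n + 1" \<Omega> \<phi>, OF L2_u(1) L2_\<phi>(1)]
      modified_energy_eq[of u n \<Omega> \<phi>, OF L2_u(2) L2_\<phi>(2)] l2_norm_power2
      add_divide_distrib diff_divide_distrib
    by linarith
qed

end
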